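(* Let $\pi:X\to B$ be a surjective morphism of smooth affine algebraic varieties over $\mathbb{C}$, so that $\mathbb{C}[B]$ is naturally embedded into $\mathbb{C}[X]$ via $\pi^*$. Suppose that $\eta$ is a locally nilpotent or semi-simple vector field on $X$ such that $\mathbb{C}[B]\subset\operatorname{Ker}\eta$. Let $\alpha_1,\dots,\alpha_k$ be regular functions on $B$ without common zeros and let $D_i=(\alpha_i\circ\pi)^{-1}(0)$. Suppose that $\xi_1,\dots,\xi_k$ are locally nilpotent vector fields on $X$ such that for each $i$ one has $\alpha_i\in\operatorname{Ker}\xi_i$ (so that $\xi_i$ is tangent to $D_i$) and the restriction of the pair $(\xi_i,\eta)$ to $X_i=X\setminus D_i$ is compatible. Then there exists a nontrivial (i.e. nonzero) ideal $J\subset\mathbb{C}[X]$ for which $J\eta\subset\mathrm{Lie}_{alg}(X)$.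
   Context: All varieties are irreducible. An algebraic vector field is identified with the corresponding derivation of the ring of regular functions and $\operatorname{Ker}$ denotes its kernel. A vector field is complete if it is generated by a holomorphic $\mathbb{C}_+$-action (its phase flow). A complete algebraic vector field is locally nilpotent if its phase flow is an algebraic $\mathbb{C}_+$-action; it is semi-simple if its phase flow factors through $\mathbb{C}^*$ and generates an algebraic $\mathbb{C}^*$-action. A pair $(\xi,\eta)$ of nontrivial complete algebraic vector fields on a smooth affine variety $X$ is semi-compatible if the linear span of $\operatorname{Ker}\xi\cdot\operatorname{Ker}\eta$ (products of elements of the kernels in $\mathbb{C}[X]$) contains a nonzero ideal of $\mathbb{C}[X]$. A semi-compatible pair $(\xi,\eta)$ is compatible if $\xi$ is locally nilpotent and there exists $a\in\operatorname{Ker}\eta$ with $\xi(a)\ne0$ and $\xi^2(a)=0$. $\mathrm{Lie}_{alg}(X)$ is the Lie algebra generated by all complete algebraic vector fields on $X$. *)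

theory Defs
  imports "HOL-Analysis.Analysis" "HOL-Algebra.Ideal" "HOL-Library.Function_Algebras"
begin

section \<open>Affine spaces, Zariski topology, regular functions\<close>

text \<open>
  The class only records the affine coordinate functions of the ambient space, so that
  polynomial functions, regular functions and morphisms are defined once for subsets of
  both \<open>\<complex>\<^sup>n\<close> and \<open>\<complex> \<times> \<complex>\<^sup>n\<close> (the latter is needed for algebraic actions).
\<close>

class affine_space =
  fixes coords :: "('a \<Rightarrow> complex) set"

instantiation complex :: affine_space
begin
definition coords_complex :: "(complex \<Rightarrow> complex) set" where
  "coords_complex = {\<lambda>z. z}"
instance ..
end

instantiation vec :: (affine_space, finite) affine_space
begin
definition coords_vec :: "('a ^ 'b \<Rightarrow> complex) set" where
  "coords_vec = {\<lambda>x. c (x $ i) | c i. c \<in> coords}"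
instance ..
end

instantiation prod :: (affine_space, affine_space) affine_space
begin
definition coords_prod :: "('a \<times> 'b \<Rightarrow> complex) set" where
  "coords_prod = {\<lambda>p. c (fst p) | c. c \<in> coords} \<union> {\<lambda>p. c (snd p) | c. c \<in> coords}"
instance ..
end

lemma coords_complex_vec:
  "(coords :: (complex ^ 'n \<Rightarrow> complex) set) = range (\<lambda>i x. x $ i)"
  by (auto simp: coords_vec_def coords_complex_def)

inductive_set polynomial_functions :: "('a::affine_space \<Rightarrow> complex) set" where
  const: "(\<lambda>_. c) \<in> polynomial_functions"
| coord: "f \<in> coords \<Longrightarrow> f \<in> polynomial_functions"
| add: "\<lbrakk>f \<in> polynomial_functions; g \<in> polynomial_functions\<rbrakk>
    \<Longrightarrow> (\<lambda>x. f x + g x) \<in> polynomial_functions"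
| mult: "\<lbrakk>f \<in> polynomial_functions; g \<in> polynomial_functions\<rbrakk>
    \<Longrightarrow> (\<lambda>x. f x * g x) \<in> polynomial_functions"

definition zariski_closed :: "'a::affine_space set \<Rightarrow> bool" where
  "zariski_closed Z \<longleftrightarrow> (\<exists>S \<subseteq> polynomial_functions. Z = {x. \<forall>f\<in>S. f x = 0})"

definition zariski_open :: "'a::affine_space set \<Rightarrow> bool" where
  "zariski_open W \<longleftrightarrow> zariski_closed (- W)"

definition zariski_irreducible :: "'a::affine_space set \<Rightarrow> bool" where
  "zariski_irreducible X \<longleftrightarrow> X \<noteq> {} \<and>
     (\<forall>Z1 Z2. zariski_closed Z1 \<and> zariski_closed Z2 \<and> X \<subseteq> Z1 \<union> Z2 \<longrightarrow> X \<subseteq> Z1 \<or> X \<subseteq> Z2)"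

definition affine_variety :: "'a::affine_space set \<Rightarrow> bool" where
  "affine_variety X \<longleftrightarrow> zariski_closed X \<and> zariski_irreducible X"

text \<open>Krull dimension. The set of lengths of chains is bounded by the number of coordinates,
  so the supremum of natural numbers is a genuine one.\<close>

definition variety_dim :: "'a::affine_space set \<Rightarrow> nat" where
  "variety_dim X = Sup {d. \<exists>Z :: nat \<Rightarrow> 'a set.
     (\<forall>i\<le>d. affine_variety (Z i) \<and> Z i \<subseteq> X) \<and> (\<forall>i<d. Z i \<subset> Z (Suc i))}"

definition zariski_tangent_space :: "(complex ^ 'n) set \<Rightarrow> complex ^ 'n \<Rightarrow> (complex ^ 'n) set" where
  "zariski_tangent_space X p =
     {v. \<forall>f\<in>polynomial_functions. (\<forall>x\<in>X. f x = 0) \<longrightarrow> frechet_derivative f (at p) v = 0}"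

definition smooth_affine_variety :: "(complex ^ 'n) set \<Rightarrow> bool" where
  "smooth_affine_variety X \<longleftrightarrow> affine_variety X \<and>
     (\<forall>p\<in>X. vec.dim (zariski_tangent_space X p) = variety_dim X)"

text \<open>
  A function on \<open>U\<close> is represented by its extension by zero to the ambient space, so that
  equality of functions on \<open>U\<close> is equality in HOL.
\<close>

definition restr :: "'a set \<Rightarrow> ('a \<Rightarrow> complex) \<Rightarrow> 'a \<Rightarrow> complex" where
  "restr U f = (\<lambda>x. if x \<in> U then f x else 0)"

text \<open>Regular functions on a locally closed subset \<open>U\<close> (a closed subvariety, a complement
  \<open>X - D\<close> in it, a product with \<open>\<complex>\<close> or \<open>\<complex>\<^sup>*\<close>): locally quotients of polynomials.\<close>

definition regular_functions :: "'a::affine_space set \<Rightarrow> ('a \<Rightarrow> complex) set" where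
  "regular_functions U = {f. (\<forall>x. x \<notin> U \<longrightarrow> f x = 0) \<and>
     (\<forall>x\<in>U. \<exists>W. zariski_open W \<and> x \<in> W \<and>
        (\<exists>p\<in>polynomial_functions. \<exists>q\<in>polynomial_functions.
           \<forall>y \<in> U \<inter> W. q y \<noteq> 0 \<and> f y = p y / q y))}"

definition coordinate_ring :: "'a::affine_space set \<Rightarrow> ('a \<Rightarrow> complex) ring" where
  "coordinate_ring U = \<lparr>carrier = regular_functions U, mult = (\<lambda>f g. f * g),
     one = restr U (\<lambda>_. 1), zero = 0, add = (\<lambda>f g. f + g)\<rparr>"

definition pullback :: "'a set \<Rightarrow> ('a \<Rightarrow> 'b) \<Rightarrow> ('b \<Rightarrow> complex) \<Rightarrow> 'a \<Rightarrow> complex" where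
  "pullback U \<phi> g = restr U (g \<circ> \<phi>)"

text \<open>Morphisms into an affine variety \<open>V\<close>; all targets below are affine (closed
  subvarieties, or complements in them of the zero locus of one regular function).\<close>

definition morphism_on ::
    "'a::affine_space set \<Rightarrow> 'b::affine_space set \<Rightarrow> ('a \<Rightarrow> 'b) \<Rightarrow> bool" where
  "morphism_on U V \<phi> \<longleftrightarrow> \<phi> ` U \<subseteq> V \<and>
     (\<forall>g\<in>regular_functions V. pullback U \<phi> g \<in> regular_functions U)"

definition zero_locus :: "'a set \<Rightarrow> ('a \<Rightarrow> complex) \<Rightarrow> 'a set" where
  "zero_locus U f = {x\<in>U. f x = 0}"


section \<open>Algebraic vector fields\<close>

type_synonym 'a vector_field = "('a \<Rightarrow> complex) \<Rightarrow> ('a \<Rightarrow> complex)"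

text \<open>
  Derivations of \<open>\<complex>[U]\<close>, extended by zero to functions outside \<open>\<complex>[U]\<close>, so that
  equality of vector fields on \<open>U\<close> is equality in HOL.
\<close>

definition vector_fields ::
    "'a::affine_space set \<Rightarrow> 'a vector_field set" where
  "vector_fields U = {D.
     (\<forall>f. f \<notin> regular_functions U \<longrightarrow> D f = 0) \<and>
     (\<forall>f\<in>regular_functions U. D f \<in> regular_functions U) \<and>
     (\<forall>f\<in>regular_functions U. \<forall>g\<in>regular_functions U. D (f + g) = D f + D g) \<and>
     (\<forall>c. \<forall>f\<in>regular_functions U. D (\<lambda>x. c * f x) = (\<lambda>x. c * D f x)) \<and>
     (\<forall>f\<in>regular_functions U. \<forall>g\<in>regular_functions U. D (f * g) = f * D g + g * D f)}"

definition Ker ::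
    "'a::affine_space set \<Rightarrow> 'a vector_field \<Rightarrow> ('a \<Rightarrow> complex) set" where
  "Ker U D = {f \<in> regular_functions U. D f = 0}"

text \<open>Restriction of a vector field on \<open>X\<close> to the complement \<open>U\<close> of the zero locus of a regular
  function: the unique derivation of \<open>\<complex>[U]\<close> compatible with the restriction of functions
  \<open>\<complex>[X] \<rightarrow> \<complex>[U]\<close>.\<close>

definition restrict_field ::
    "'a::affine_space set \<Rightarrow> 'a set \<Rightarrow> 'a vector_field \<Rightarrow> 'a vector_field" where
  "restrict_field X U D = (THE D'. D' \<in> vector_fields U \<and>
     (\<forall>f\<in>regular_functions X. D' (restr U f) = restr U (D f)))"

text \<open>Holomorphic functions on \<open>S \<subseteq> \<complex> \<times> \<complex>\<^sup>n\<close>: locally restrictions of holomorphic functions on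
  open subsets of the ambient space. When \<open>S\<close> is a locally closed complex submanifold (here
  \<open>S = \<complex> \<times> U\<close> with \<open>U\<close> smooth) this is holomorphy on the complex manifold \<open>S\<close>.\<close>

definition holomorphic_fun_on ::
    "(complex \<times> (complex ^ 'n)) set \<Rightarrow> (complex \<times> (complex ^ 'n) \<Rightarrow> complex) \<Rightarrow> bool" where
  "holomorphic_fun_on S g \<longleftrightarrow> (\<forall>z\<in>S. \<exists>W G. open W \<and> z \<in> W \<and>
     (\<forall>w\<in>W. \<exists>G'. (G has_derivative G') (at w) \<and>
        (\<forall>c s v. G' (c * s, c *s v) = c * G' (s, v))) \<and>
     (\<forall>w \<in> S \<inter> W. g w = G w))"

definition holomorphic_action ::
    "(complex ^ 'n) set \<Rightarrow> (complex \<Rightarrow> complex ^ 'n \<Rightarrow> complex ^ 'n) \<Rightarrow> bool" where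
  "holomorphic_action U \<Phi> \<longleftrightarrow>
     (\<forall>t. \<forall>x\<in>U. \<Phi> t x \<in> U) \<and>
     (\<forall>x\<in>U. \<Phi> 0 x = x) \<and>
     (\<forall>s t. \<forall>x\<in>U. \<Phi> (s + t) x = \<Phi> s (\<Phi> t x)) \<and>
     (\<forall>i. holomorphic_fun_on (UNIV \<times> U) (\<lambda>(t, x). \<Phi> t x $ i))"

definition phase_flow ::
    "(complex ^ 'n) set \<Rightarrow> (complex ^ 'n) vector_field \<Rightarrow> (complex \<Rightarrow> complex ^ 'n \<Rightarrow> complex ^ 'n) \<Rightarrow> bool" where
  "phase_flow U D \<Phi> \<longleftrightarrow> holomorphic_action U \<Phi> \<and>
     (\<forall>f\<in>regular_functions U. \<forall>x\<in>U. ((\<lambda>t. f (\<Phi> t x)) has_field_derivative D f x) (at 0))"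

definition complete_field ::
    "(complex ^ 'n) set \<Rightarrow> (complex ^ 'n) vector_field \<Rightarrow> bool" where
  "complete_field U D \<longleftrightarrow> D \<in> vector_fields U \<and> (\<exists>\<Phi>. phase_flow U D \<Phi>)"

definition locally_nilpotent ::
    "(complex ^ 'n) set \<Rightarrow> (complex ^ 'n) vector_field \<Rightarrow> bool" where
  "locally_nilpotent U D \<longleftrightarrow> D \<in> vector_fields U \<and>
     (\<exists>\<Phi>. phase_flow U D \<Phi> \<and> morphism_on (UNIV \<times> U) U (\<lambda>(t, x). \<Phi> t x))"

definition algebraic_torus_action ::
    "(complex ^ 'n) set \<Rightarrow> (complex \<Rightarrow> complex ^ 'n \<Rightarrow> complex ^ 'n) \<Rightarrow> bool" where
  "algebraic_torus_action U \<Psi> \<longleftrightarrow>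
     morphism_on ((- {0}) \<times> U) U (\<lambda>(s, x). \<Psi> s x) \<and>
     (\<forall>x\<in>U. \<Psi> 1 x = x) \<and>
     (\<forall>s t. s \<noteq> 0 \<and> t \<noteq> 0 \<longrightarrow> (\<forall>x\<in>U. \<Psi> (s * t) x = \<Psi> s (\<Psi> t x)))"

text \<open>The surjective holomorphic homomorphisms \<open>\<complex> \<rightarrow> \<complex>\<^sup>*\<close>, through one of which the flow has to
  factor, are the maps \<open>t \<mapsto> exp (\<mu> t)\<close> with \<open>\<mu> \<noteq> 0\<close>.\<close>

definition semi_simple ::
    "(complex ^ 'n) set \<Rightarrow> (complex ^ 'n) vector_field \<Rightarrow> bool" where
  "semi_simple U D \<longleftrightarrow> D \<in> vector_fields U \<and>
     (\<exists>\<Phi>. phase_flow U D \<Phi> \<and>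
       (\<exists>\<mu> \<Psi>. \<mu> \<noteq> 0 \<and> algebraic_torus_action U \<Psi> \<and> (\<forall>t. \<forall>x\<in>U. \<Phi> t x = \<Psi> (exp (\<mu> * t)) x)))"


section \<open>Compatible pairs\<close>

definition semi_compatible ::
    "(complex ^ 'n) set \<Rightarrow> (complex ^ 'n) vector_field \<Rightarrow> (complex ^ 'n) vector_field \<Rightarrow> bool" where
  "semi_compatible U \<xi> \<eta> \<longleftrightarrow>
     complete_field U \<xi> \<and> \<xi> \<noteq> 0 \<and> complete_field U \<eta> \<and> \<eta> \<noteq> 0 \<and>
     (\<exists>I. ideal I (coordinate_ring U) \<and> I \<noteq> {0} \<and>
        I \<subseteq> module.span (\<lambda>c f x. c * f x) {f * g | f g. f \<in> Ker U \<xi> \<and> g \<in> Ker U \<eta>})"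

definition compatible ::
    "(complex ^ 'n) set \<Rightarrow> (complex ^ 'n) vector_field \<Rightarrow> (complex ^ 'n) vector_field \<Rightarrow> bool" where
  "compatible U \<xi> \<eta> \<longleftrightarrow> semi_compatible U \<xi> \<eta> \<and> locally_nilpotent U \<xi> \<and>
     (\<exists>a \<in> Ker U \<eta>. \<xi> a \<noteq> 0 \<and> \<xi> (\<xi> a) = 0)"


section \<open>The Lie algebra generated by complete algebraic vector fields\<close>

definition lie_bracket :: "'a vector_field \<Rightarrow> 'a vector_field \<Rightarrow> 'a vector_field" where
  "lie_bracket D E = (\<lambda>f. D (E f) - E (D f))"

inductive_set Lie_alg ::
    "(complex ^ 'n) set \<Rightarrow> (complex ^ 'n) vector_field set"
  for X :: "(complex ^ 'n) set" where
  complete: "complete_field X D \<Longrightarrow> D \<in> Lie_alg X"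
| zero: "0 \<in> Lie_alg X"
| add: "\<lbrakk>D \<in> Lie_alg X; E \<in> Lie_alg X\<rbrakk> \<Longrightarrow> D + E \<in> Lie_alg X"
| scale: "D \<in> Lie_alg X \<Longrightarrow> (\<lambda>f x. c * D f x) \<in> Lie_alg X"
| bracket: "\<lbrakk>D \<in> Lie_alg X; E \<in> Lie_alg X\<rbrakk> \<Longrightarrow> lie_bracket D E \<in> Lie_alg X"

end

(*
  For f in Ker xi_i, g, a in Ker eta with xi_i^2(a) = 0, the fields f xi_i, a f xi_i, g eta and
  a g eta are complete, and a difference of two brackets of them is f g xi_i(a) eta.  Compatibility
  on X_i = X - D_i therefore puts h w_i eta into the Lie algebra for a fixed nonzero w_i and every
  regular h, up to a factor alpha_i^m with m depending on h.  Since the alpha_i have no common zeros,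
  the Nullstellensatz on B gives 1 = sum_i beta_i alpha_i^(m_i), and the coefficients beta_i lie in
  Ker eta, so they can be absorbed.  Hence J is the principal ideal generated by the product of the
  w_i, which is nonzero because X is irreducible.
*)

theory Submission
  imports Defs "HOL-Complex_Analysis.Cauchy_Integral_Formula"
    "HOL-Computational_Algebra.Fundamental_Theorem_Algebra"
begin

section \<open>The Nullstellensatz over the complex numbers\<close>

text \<open>The generators of \<open>Lie_alg X\<close> must be complete on \<open>X\<close> itself,
  so nothing can be bracketed on \<open>X_i\<close>. As \<alpha>_i lies in the kernels of both
  fields, multiplying kernel elements on \<open>X_i\<close> by powers of \<alpha>_i keeps them in
  the kernels and eventually extends them to \<open>X\<close>; the bracket identity is used only
  there. The price is an exponent for every product in a span representation, with no uniform bound,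
  so it cannot be absorbed into w_i. The order of quantifiers resolves this: w_i first, then h, then
  the exponents, and only then the coefficients, which range over all of Ker \<eta>. The partition
  of unity is therefore formed for exponents already fixed, and on \<open>B\<close>, since
  coefficients taken on \<open>X\<close> would in general not be killed by \<eta>. Completeness of u
  D for D (D u) = 0 comes from an explicit change of time, holomorphic but in general not algebraic.
  Regular functions are local quotients, so their representation by polynomials, with powers of
  \<alpha>_i as denominators on \<open>X_i\<close>, already rests on the Nullstellensatz, which is
  derived from the uncountability of the complex numbers.\<close>

interpretation cfun: vector_space "\<lambda>(c::complex) (f::'a \<Rightarrow> complex) x. c * f x"
  by standard (auto simp: fun_eq_iff algebra_simps)

lemma power_fun_apply [simp]: "(f ^ n) x = (f x :: complex) ^ n"
  by (induction n) auto

lemma sum_fun_apply [simp]: "(\<Sum>i\<in>A. f i) x = (\<Sum>i\<in>A. f i x :: complex)"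
  by (induction A rule: infinite_finite_induct) auto

section \<open>Polynomial functions and their ideals\<close>

abbreviation Pol :: "('a::affine_space \<Rightarrow> complex) set" where
  "Pol \<equiv> polynomial_functions"

lemma Pol_const [intro, simp]: "(\<lambda>_. c) \<in> Pol"
  by (rule polynomial_functions.const)

lemma Pol_zero [intro, simp]: "0 \<in> Pol"
  unfolding zero_fun_def by simp

lemma Pol_one [intro, simp]: "1 \<in> Pol"
  unfolding one_fun_def by simp

lemma Pol_add [intro]: "f \<in> Pol \<Longrightarrow> g \<in> Pol \<Longrightarrow> f + g \<in> Pol"
  unfolding plus_fun_def by (rule polynomial_functions.add)

lemma Pol_mult [intro]: "f \<in> Pol \<Longrightarrow> g \<in> Pol \<Longrightarrow> f * g \<in> Pol"
  unfolding times_fun_def by (rule polynomial_functions.mult)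

lemma Pol_uminus [intro]: "f \<in> Pol \<Longrightarrow> - f \<in> Pol"
  using Pol_mult[of "\<lambda>_. -1" f] by (simp add: times_fun_def fun_Compl_def)

lemma Pol_diff [intro]: "f \<in> Pol \<Longrightarrow> g \<in> Pol \<Longrightarrow> f - g \<in> Pol"
  using Pol_add[of f "- g"] by auto

lemma Pol_power [intro]: "f \<in> Pol \<Longrightarrow> f ^ n \<in> Pol"
  by (induction n) auto

lemma Pol_poly: "f \<in> Pol \<Longrightarrow> (\<lambda>x. poly r (f x)) \<in> Pol"
  by (induction r) (simp_all add: zero_fun_def[symmetric] polynomial_functions.intros)

text \<open>Kept as a plain set of functions, so that computations use the pointwise ring operations
  of the function type directly.\<close>

definition pideal :: "('a::affine_space \<Rightarrow> complex) set \<Rightarrow> bool" where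
  "pideal I \<longleftrightarrow> I \<subseteq> Pol \<and> 0 \<in> I \<and> (\<forall>f\<in>I. \<forall>g\<in>I. f + g \<in> I) \<and> (\<forall>f\<in>I. \<forall>g\<in>Pol. g * f \<in> I)"

lemma pidealD:
  assumes "pideal I"
  shows "I \<subseteq> Pol" "0 \<in> I" "\<And>f g. f \<in> I \<Longrightarrow> g \<in> I \<Longrightarrow> f + g \<in> I"
    "\<And>f g. f \<in> I \<Longrightarrow> g \<in> Pol \<Longrightarrow> g * f \<in> I"
  using assms by (simp_all add: pideal_def)

lemma pideal_diff: "pideal I \<Longrightarrow> f \<in> I \<Longrightarrow> g \<in> I \<Longrightarrow> f - g \<in> I"
  using pidealD(3)[of I f "(\<lambda>_. -1) * g"] pidealD(4)[of I g "\<lambda>_. -1"]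
  by (simp add: times_fun_def plus_fun_def fun_diff_def)

lemma pideal_sum: "pideal I \<Longrightarrow> (\<And>i. i \<in> A \<Longrightarrow> f i \<in> I) \<Longrightarrow> (\<Sum>i\<in>A. f i) \<in> I"
  by (induction A rule: infinite_finite_induct) (auto intro: pidealD)

text \<open>Monomials are products of lists of coordinates, so the product of two monomials belongs
  to the concatenated list and the span is closed under multiplication. Lists over a finite set are
  countable, which bounds the dimension.\<close>

lemma Pol_span:
  "(f :: 'a::affine_space \<Rightarrow> complex) \<in> Pol \<Longrightarrow> f \<in> cfun.span (prod_list ` lists coords)"
proof (induction rule: polynomial_functions.induct)
  case (const c)
  have "(\<lambda>x::'a. c * (prod_list [] :: 'a \<Rightarrow> complex) x) \<in> cfun.span (prod_list ` lists coords)"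
    by (intro cfun.span_scale cfun.span_base) blast
  then show ?case by simp
next
  case (coord f)
  then show ?case
    by (intro cfun.span_base image_eqI[of _ _ "[f]"]) auto
next
  case (add f g)
  then show ?case using cfun.span_add by (simp add: plus_fun_def)
next
  case (mult f g)
  let ?M = "prod_list ` lists (coords :: ('a \<Rightarrow> complex) set)"
  have 1: "m * h \<in> cfun.span ?M" if m: "m \<in> ?M" and h: "h \<in> cfun.span ?M" for m h
    using h
  proof (induction rule: cfun.span_induct_alt)
    case base
    show ?case using cfun.span_zero[of ?M] by (simp add: times_fun_def zero_fun_def)
  next
    case (step c x y)
    have "m * x \<in> ?M"
    proof -
      obtain xs ys where "m = prod_list xs" "x = prod_list ys" "xs \<in> lists coords" "ys \<in> lists coords"
        using m step by auto
      then show ?thesis by (intro image_eqI[of _ _ "xs @ ys"]) auto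
    qed
    then have "(\<lambda>t. c * (m * x) t) + m * y \<in> cfun.span ?M"
      by (intro cfun.span_add cfun.span_scale[of _ _ c] cfun.span_base step)
    then show ?case by (simp add: algebra_simps fun_eq_iff plus_fun_def times_fun_def)
  qed
  have "f * g \<in> cfun.span ?M"
    using mult.IH(1)
  proof (induction rule: cfun.span_induct_alt)
    case base
    show ?case using cfun.span_zero[of ?M] by (simp add: times_fun_def zero_fun_def)
  next
    case (step c x y)
    have "(\<lambda>t. c * (x * g) t) + y * g \<in> cfun.span ?M"
      by (intro cfun.span_add cfun.span_scale[of _ _ c] 1 mult.IH step)
    then show ?case by (simp add: algebra_simps fun_eq_iff plus_fun_def times_fun_def)
  qed
  then show ?case by (simp add: times_fun_def)
qed

section \<open>Countable dimension against uncountably many residue values\<close>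

lemma Pol_finite_dimensional_exhaustion:
  assumes "finite (coords :: ('a::affine_space \<Rightarrow> complex) set)"
  obtains M :: "nat \<Rightarrow> ('a::affine_space \<Rightarrow> complex) set"
  where "\<And>n. finite (M n)" "Pol \<subseteq> (\<Union>n. cfun.span (M n))"
proof -
  let ?M = "prod_list ` lists (coords :: ('a \<Rightarrow> complex) set)"
  have "countable ?M" using assms by (intro countable_image countable_lists countable_finite)
  moreover have "?M \<noteq> {}" by auto
  ultimately obtain e :: "nat \<Rightarrow> ('a \<Rightarrow> complex)" where e: "?M = range e"
    by (metis range_from_nat_into)
  have "f \<in> (\<Union>n. cfun.span (e ` {..n}))" if "f \<in> Pol" for f
  proof -
    have "f \<in> cfun.span (range e)" using Pol_span[OF that] e by simp
    then obtain t r where t: "finite t" "t \<subseteq> range e" and f: "f = (\<Sum>a\<in>t. (\<lambda>x. r a * a x))"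
      unfolding cfun.span_explicit by auto
    obtain C where C: "finite C" "t = e ` C"
      using finite_subset_image[OF t] by blast
    have "t \<subseteq> e ` {..Max C}"
      using C by auto
    then have "f \<in> cfun.span (e ` {..Max C})"
      unfolding f by (intro cfun.span_sum cfun.span_scale cfun.span_base) auto
    then show ?thesis by blast
  qed
  then show thesis by (intro that[of "\<lambda>n. e ` {..n}"]) auto
qed

text \<open>Over the complex numbers \<open>r\<close> splits into linear factors, and each
  \<open>f - d\<close> is a unit modulo \<open>I\<close>. The factors can be cancelled one at a time
  until a nonzero constant is left in \<open>I\<close>.\<close>

lemma one_in_pideal_of_poly:
  assumes I: "pideal I" and f: "f \<in> Pol"
    and inv: "\<And>c. \<exists>q\<in>Pol. (f - (\<lambda>_. c)) * q - 1 \<in> I"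
  shows "r \<noteq> 0 \<Longrightarrow> (\<lambda>x. poly r (f x)) \<in> I \<Longrightarrow> 1 \<in> I"
proof (induction "degree r" arbitrary: r rule: less_induct)
  case (less r)
  show ?case
  proof (cases "degree r = 0")
    case True
    then obtain a where r: "r = [:a:]" by (metis degree_eq_zeroE)
    with less have "a \<noteq> 0" "(\<lambda>_. a) \<in> I" by auto
    then have "(\<lambda>_. 1 / a) * (\<lambda>_. a) \<in> I"
      using pidealD(4)[OF I] by blast
    moreover have "(\<lambda>_. 1 / a) * (\<lambda>_. a) = (1 :: 'a \<Rightarrow> complex)"
      using \<open>a \<noteq> 0\<close> by (auto simp: fun_eq_iff)
    ultimately show ?thesis by simp
  next
    case False
    then obtain d where "poly r d = 0"
      using fundamental_theorem_of_algebra[of r] by (auto simp: constant_degree)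
    then obtain s where r: "r = [:-d, 1:] * s" by (auto simp: poly_eq_0_iff_dvd)
    then have s: "s \<noteq> 0" using less by auto
    then have deg: "degree s < degree r" unfolding r by (subst degree_mult_eq) auto
    obtain q where q: "q \<in> Pol" "(f - (\<lambda>_. d)) * q - 1 \<in> I" using inv by blast
    define S where "S = (\<lambda>x. poly s (f x))"
    have S: "S \<in> Pol" unfolding S_def using f by (rule Pol_poly)
    have "(\<lambda>x. poly r (f x)) = (f - (\<lambda>_. d)) * S"
      unfolding r S_def by (auto simp: fun_eq_iff algebra_simps)
    then have "q * ((f - (\<lambda>_. d)) * S) \<in> I"
      using pidealD(4)[OF I less(3) q(1)] by simp
    moreover have "S * ((f - (\<lambda>_. d)) * q - 1) \<in> I"
      using pidealD(4)[OF I q(2) S] .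
    \<comment> \<open>The difference is exactly \<open>S\<close>: multiplication by \<open>q\<close>
      cancels the factor \<open>f - d\<close> modulo \<open>I\<close>.\<close>
    ultimately have "q * ((f - (\<lambda>_. d)) * S) - S * ((f - (\<lambda>_. d)) * q - 1) \<in> I"
      by (rule pideal_diff[OF I])
    then have "S \<in> I" by (simp add: algebra_simps)
    then show ?thesis using less(1)[OF deg s] unfolding S_def by blast
  qed
qed

text \<open>Were \<open>f - c\<close> invertible modulo \<open>I\<close> for every \<open>c\<close>, its inverses would be an uncountable
  family in a space of countable dimension; a linear relation among them becomes a polynomial
  relation for \<open>f\<close> after clearing denominators.\<close>

lemma exists_residue_value:
  assumes fin: "finite (coords :: ('a::affine_space \<Rightarrow> complex) set)"
    and I: "pideal (I :: ('a \<Rightarrow> complex) set)" "1 \<notin> I" and f: "f \<in> Pol"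
  shows "\<exists>c. \<forall>q\<in>Pol. (f - (\<lambda>_. c)) * q - 1 \<notin> I"
proof (rule ccontr)
  assume "\<not> ?thesis"
  then have ex: "\<exists>q\<in>Pol. (f - (\<lambda>_. c)) * q - 1 \<in> I" for c by blast
  then obtain q where q: "\<And>c. q c \<in> Pol" "\<And>c. (f - (\<lambda>_. c)) * q c - 1 \<in> I" by metis
  \<comment> \<open>If one \<open>q\<close> inverts both \<open>f - c\<close> and
    \<open>f - d\<close>, then subtraction puts \<open>(c - d) * q\<close> into \<open>I\<close>,
    hence \<open>q\<close>, hence 1.\<close>
  have inj: "inj q"
  proof (rule injI, rule ccontr)
    fix c d assume e: "q c = q d" and ne: "c \<noteq> d"
    have "((f - (\<lambda>_. d)) * q d - 1) - ((f - (\<lambda>_. c)) * q c - 1) \<in> I"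
      using pideal_diff[OF I(1)] q by blast
    then have "(\<lambda>_. 1 / (c - d)) * (((f - (\<lambda>_. d)) * q d - 1) - ((f - (\<lambda>_. c)) * q c - 1)) \<in> I"
      by (rule pidealD(4)[OF I(1)]) simp
    moreover have "(\<lambda>_. 1 / (c - d)) * (((f - (\<lambda>_. d)) * q d - 1) - ((f - (\<lambda>_. c)) * q c - 1)) = q c"
    proof
      fix x
      have "(f x - d) * q c x - (f x - c) * q c x = (c - d) * q c x" by (simp add: algebra_simps)
      then show "((\<lambda>_. 1 / (c - d)) * (((f - (\<lambda>_. d)) * q d - 1) - ((f - (\<lambda>_. c)) * q c - 1))) x = q c x"
        using ne by (simp add: e[symmetric])
    qed
    ultimately have "q c \<in> I" by simp
    then have "(f - (\<lambda>_. c)) * q c \<in> I"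
      using pidealD(4)[OF I(1)] f by blast
    then have "(f - (\<lambda>_. c)) * q c - ((f - (\<lambda>_. c)) * q c - 1) \<in> I"
      using pideal_diff[OF I(1)] q by blast
    then show False using I(2) by simp
  qed
  obtain M :: "nat \<Rightarrow> ('a \<Rightarrow> complex) set"
    where M: "\<And>n. finite (M n)" "Pol \<subseteq> (\<Union>n. cfun.span (M n))"
    using Pol_finite_dimensional_exhaustion[OF fin] by blast
  \<comment> \<open>Countably many finite-dimensional spaces cover all inverses, so one of them
    contains infinitely many and these are linearly dependent.\<close>
  have "\<exists>n. uncountable {c. q c \<in> cfun.span (M n)}"
  proof (rule ccontr)
    assume "\<not> ?thesis"
    then have "countable (\<Union>n. {c. q c \<in> cfun.span (M n)})" by auto
    moreover have "(\<Union>n. {c. q c \<in> cfun.span (M n)}) = UNIV" using subsetD[OF M(2) q(1)] by blast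
    ultimately show False using uncountable_UNIV_complex by simp
  qed
  then obtain n where "infinite {c. q c \<in> cfun.span (M n)}" using countable_finite by blast
  then have "infinite (q ` {c. q c \<in> cfun.span (M n)})"
    using finite_imageD[OF _ inj_on_subset[OF inj subset_UNIV]] by blast
  moreover have "q ` {c. q c \<in> cfun.span (M n)} \<subseteq> cfun.span (M n)" by auto
  ultimately have "cfun.dependent (q ` {c. q c \<in> cfun.span (M n)})"
    using cfun.independent_span_bound[OF M(1)] by blast
  then obtain T u v where T': "finite T" "T \<subseteq> q ` {c. q c \<in> cfun.span (M n)}" "v \<in> T" "u v \<noteq> 0"
    and rel: "(\<Sum>v\<in>T. (\<lambda>x. u v * v x)) = 0"
    by (subst (asm) cfun.dependent_explicit) (elim exE conjE bexE)
  from T' have T: "finite T" "T \<subseteq> range q" "v \<in> T" "u v \<noteq> 0" by auto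
  obtain C where C: "finite C" "T = q ` C" using finite_subset_image[OF T(1,2)] by blast
  obtain c0 where c0: "c0 \<in> C" "u (q c0) \<noteq> 0" using T C by blast
  have rel: "(\<Sum>c\<in>C. u (q c) * q c x) = 0" for x
  proof -
    have "(\<Sum>v\<in>T. u v * v x) = 0" using fun_cong[OF rel, of x] by simp
    then show ?thesis unfolding C(2) using inj by (subst (asm) sum.reindex) (auto intro: inj_on_subset)
  qed
  \<comment> \<open>The relation with the common denominator cleared: \<open>L c\<close> is the
    product of all factors but the one at \<open>c\<close>. Only \<open>L c0\<close> survives at
    \<open>c0\<close>, so \<open>r\<close> is not zero.\<close>
  define L where "L = (\<lambda>c. \<Prod>d\<in>C - {c}. [:-d, 1:])"
  define r where "r = (\<Sum>c\<in>C. smult (u (q c)) (L c))"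
  have "poly (L c) c0 = 0" if "c \<in> C" "c \<noteq> c0" for c
    unfolding L_def poly_prod using C(1) that c0 by (intro prod_zero) auto
  then have "poly r c0 = u (q c0) * poly (L c0) c0"
    unfolding r_def poly_sum using C(1) c0 by (subst sum.remove[of _ c0]) auto
  moreover have "poly (L c0) c0 \<noteq> 0"
    unfolding L_def poly_prod using C(1) by (auto simp: prod_zero_iff)
  ultimately have r0: "r \<noteq> 0" using c0 by auto
  \<comment> \<open>Multiplying \<open>L c\<close> by \<open>(f - c) * q c\<close>, which is 1
    modulo \<open>I\<close>, restores the full product over \<open>C\<close>. That product factors
    out of the sum, and the linear relation annihilates the rest.\<close>
  have "(\<lambda>x. poly r (f x)) = (\<Sum>c\<in>C. (\<lambda>x. - u (q c) * poly (L c) (f x)) * ((f - (\<lambda>_. c)) * q c - 1))"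
  proof
    fix x
    have "poly (L c) (f x) * (f x - c) = (\<Prod>d\<in>C. f x - d)" if "c \<in> C" for c
      unfolding L_def poly_prod using C(1) that by (subst (2) prod.remove[of _ c]) (auto simp: algebra_simps)
    then have "(\<Sum>c\<in>C. u (q c) * q c x * (poly (L c) (f x) * (f x - c)))
        = (\<Sum>c\<in>C. u (q c) * q c x * (\<Prod>d\<in>C. f x - d))"
      by (intro sum.cong) auto
    also have "\<dots> = 0" using rel[of x] by (simp flip: sum_distrib_right)
    finally have 0: "(\<Sum>c\<in>C. u (q c) * q c x * (poly (L c) (f x) * (f x - c))) = 0" .
    have "poly r (f x) = (\<Sum>c\<in>C. u (q c) * poly (L c) (f x))"
      unfolding r_def by (simp add: poly_sum)
    also have "\<dots> = \<dots> - (\<Sum>c\<in>C. u (q c) * q c x * (poly (L c) (f x) * (f x - c)))"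
      unfolding 0 by simp
    also have "\<dots> = (\<Sum>c\<in>C. (\<lambda>x. - u (q c) * poly (L c) (f x)) * ((f - (\<lambda>_. c)) * q c - 1)) x"
      by (simp flip: sum_subtractf add: algebra_simps)
    finally show "poly r (f x) = \<dots>" .
  qed
  also have "\<dots> \<in> I"
  proof (rule pideal_sum[OF I(1)], rule pidealD(4)[OF I(1) q(2)])
    fix c
    show "(\<lambda>x. - u (q c) * poly (L c) (f x)) \<in> Pol"
      using Pol_poly[OF f, of "smult (- u (q c)) (L c)"] by simp
  qed
  finally show False using one_in_pideal_of_poly[OF I(1) f ex r0] I(2) by blast
qed

lemma pideal_extend:
  assumes I: "pideal I" and g: "g \<in> Pol"
  shows "pideal {h + g * p | h p. h \<in> I \<and> p \<in> Pol}" (is "pideal ?J")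
proof -
  have "f1 + f2 \<in> ?J" if "f1 \<in> ?J" "f2 \<in> ?J" for f1 f2
  proof -
    obtain h1 p1 h2 p2 where "f1 = h1 + g * p1" "f2 = h2 + g * p2" "h1 \<in> I" "h2 \<in> I"
      "p1 \<in> Pol" "p2 \<in> Pol" using \<open>f1 \<in> ?J\<close> \<open>f2 \<in> ?J\<close> by blast
    then have "f1 + f2 = (h1 + h2) + g * (p1 + p2)" "h1 + h2 \<in> I" "p1 + p2 \<in> Pol"
      using pidealD(3)[OF I] by (auto simp: algebra_simps)
    then show ?thesis by blast
  qed
  moreover have "q * f \<in> ?J" if fJ: "f \<in> ?J" and q: "q \<in> Pol" for f q
  proof -
    obtain h p where "f = h + g * p" "h \<in> I" "p \<in> Pol" using fJ by blast
    then have "q * f = q * h + g * (q * p)" "q * h \<in> I" "q * p \<in> Pol"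
      using pidealD(4)[OF I] q by (auto simp: algebra_simps)
    then show ?thesis by blast
  qed
  moreover have "0 \<in> ?J"
  proof -
    have "(0 :: 'a \<Rightarrow> complex) = 0 + g * 0" by simp
    then show ?thesis using pidealD(2)[OF I] by blast
  qed
  moreover have "?J \<subseteq> Pol" using pidealD(1)[OF I] g by blast
  ultimately show ?thesis unfolding pideal_def by blast
qed

text \<open>The coordinates are treated one by one: if \<open>x - c\<close> has no inverse modulo a
  proper ideal, it can be adjoined and the ideal stays proper. The result speaks of values \<kappa>
  and not of a point, because the class \<open>affine_space\<close> does not say that coordinates
  can be prescribed; each concrete space supplies the point.\<close>

lemma nullstellensatz_character:
  assumes fin: "finite (coords :: ('a::affine_space \<Rightarrow> complex) set)"
    and I: "pideal (I :: ('a \<Rightarrow> complex) set)" "1 \<notin> I"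
  shows "\<exists>\<kappa>. \<forall>z. (\<forall>x\<in>coords. x z = \<kappa> x) \<longrightarrow> (\<forall>f\<in>I. f z = 0)"
proof -
  have "\<exists>J \<kappa>. pideal J \<and> 1 \<notin> J \<and> I \<subseteq> J \<and> (\<forall>x\<in>S. x - (\<lambda>_. \<kappa> x) \<in> J)"
    if "S \<subseteq> coords" for S :: "('a \<Rightarrow> complex) set"
    using finite_subset[OF that fin] that
  proof (induction S rule: finite_induct)
    case empty
    then show ?case using I by blast
  next
    case (insert x S)
    then obtain J \<kappa> where J: "pideal J" "1 \<notin> J" "I \<subseteq> J" "\<forall>y\<in>S. y - (\<lambda>_. \<kappa> y) \<in> J" by blast
    have x: "x \<in> Pol" using insert by (auto intro: polynomial_functions.coord)
    obtain c where c: "\<And>q. q \<in> Pol \<Longrightarrow> (x - (\<lambda>_. c)) * q - 1 \<notin> J"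
      using exists_residue_value[OF fin J(1,2) x] by blast
    let ?J = "{h + (x - (\<lambda>_. c)) * p | h p. h \<in> J \<and> p \<in> Pol}"
    have 1: "1 \<notin> ?J"
    proof
      assume "1 \<in> ?J"
      then obtain h p where hp: "1 = h + (x - (\<lambda>_. c)) * p" "h \<in> J" "p \<in> Pol" by blast
      have "(x - (\<lambda>_. c)) * p - 1 = 0 - h" using hp(1) by (simp add: algebra_simps)
      also have "\<dots> \<in> J" using pideal_diff[OF J(1) pidealD(2)[OF J(1)] hp(2)] .
      finally show False using c hp by blast
    qed
    have JJ: "J \<subseteq> ?J"
    proof
      fix h assume "h \<in> J"
      moreover have "h = h + (x - (\<lambda>_. c)) * 0" by simp
      ultimately show "h \<in> ?J" by blast
    qed
    have xc: "x - (\<lambda>_. c) \<in> ?J"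
    proof -
      have "x - (\<lambda>_. c) = 0 + (x - (\<lambda>_. c)) * 1" by simp
      then show ?thesis using pidealD(2)[OF J(1)] by blast
    qed
    have "pideal ?J" using pideal_extend[OF J(1)] x by blast
    moreover note 1
    moreover have "I \<subseteq> ?J" using J(3) JJ by blast
    moreover have "\<forall>y\<in>insert x S. y - (\<lambda>_. (\<kappa>(x := c)) y) \<in> ?J"
    proof
      fix y assume y: "y \<in> insert x S"
      show "y - (\<lambda>_. (\<kappa>(x := c)) y) \<in> ?J"
      proof (cases "y = x")
        case True
        show ?thesis unfolding True fun_upd_same by (rule xc)
      next
        case False
        then show ?thesis using subsetD[OF JJ bspec[OF J(4)]] y
          by (simp only: fun_upd_other insert_iff simp_thms)
      qed
    qed
    ultimately show ?case by (intro exI[of _ ?J] exI[of _ "\<kappa>(x := c)"] conjI) assumption+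
  qed
  from this[OF order_refl] obtain J \<kappa> where J: "pideal J" "1 \<notin> J" "I \<subseteq> J"
    "\<forall>x\<in>coords. x - (\<lambda>_. \<kappa> x) \<in> J"
    by (elim exE conjE)
  have "f z = 0" if z: "\<forall>x\<in>coords. x z = \<kappa> x" and f: "f \<in> I" for z f
  proof -
    \<comment> \<open>Modulo \<open>J\<close> every polynomial equals its value at \<open>z\<close>.
      A nonzero value of some \<open>f\<close> in \<open>I\<close> would thus be a unit in
      \<open>J\<close>.\<close>
    have *: "g - (\<lambda>_. g z) \<in> J" if "g \<in> Pol" for g
      using that
    proof (induction rule: polynomial_functions.induct)
      case (const c)
      then show ?case using pidealD(2)[OF J(1)] by (simp add: fun_diff_def zero_fun_def)
    next
      case (coord f)
      then have "f - (\<lambda>_. \<kappa> f) \<in> J" "f z = \<kappa> f" using J(4) z by blast+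
      then show ?case by (simp only:)
    next
      case (add f g)
      then show ?case using pidealD(3)[OF J(1) add.IH] by (simp add: plus_fun_def fun_diff_def algebra_simps)
    next
      case (mult f g)
      have "f * (g - (\<lambda>_. g z)) + (\<lambda>_. g z) * (f - (\<lambda>_. f z)) \<in> J"
        by (intro pidealD[OF J(1)] mult Pol_const)
      then show ?case by (simp add: plus_fun_def times_fun_def fun_diff_def algebra_simps)
    qed
    have "f - (f - (\<lambda>_. f z)) \<in> J"
      by (rule pideal_diff[OF J(1)]) (use * f J pidealD(1)[OF I(1)] in blast)+
    then have "(\<lambda>_. 1 / f z) * (\<lambda>_. f z) \<in> J"
      using pidealD(4)[OF J(1), of "\<lambda>_. f z" "\<lambda>_. 1 / f z"] by (simp add: fun_diff_def)
    then show ?thesis using J(2) by (cases "f z = 0") (auto simp: times_fun_def one_fun_def)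
  qed
  then show ?thesis by blast
qed

lemma coord_Pol [intro, simp]: "(\<lambda>x::complex^'n. x $ i) \<in> Pol"
  by (rule polynomial_functions.coord) (simp add: coords_complex_vec)

lemma weak_nullstellensatz:
  fixes I :: "(complex^'n \<Rightarrow> complex) set"
  assumes "pideal I" and "\<And>z. \<exists>f\<in>I. f z \<noteq> 0"
  shows "1 \<in> I"
proof (rule ccontr)
  assume "1 \<notin> I"
  moreover have "finite (coords :: (complex^'n \<Rightarrow> complex) set)"
    by (simp add: coords_complex_vec)
  ultimately obtain \<kappa> where "\<And>z. (\<forall>x\<in>coords. x z = \<kappa> x) \<longrightarrow> (\<forall>f\<in>I. f z = 0)"
    using nullstellensatz_character assms(1) by blast
  from this[of "\<chi> i. \<kappa> (\<lambda>x. x $ i)"] show False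
    using assms(2) by (force simp: coords_complex_vec)
qed

section \<open>From common zeros to powers: the trick of Rabinowitsch\<close>

lemma coords_complex_prod_vec:
  "(coords :: (complex \<times> (complex^'n) \<Rightarrow> complex) set) = insert fst (range (\<lambda>i p. snd p $ i))"
  by (auto simp: coords_prod_def coords_complex_vec coords_complex_def fun_eq_iff)

lemma Pol_snd: "f \<in> Pol \<Longrightarrow> (\<lambda>p::complex \<times> (complex^'n). f (snd p)) \<in> Pol"
proof (induction rule: polynomial_functions.induct)
  case (coord f)
  then show ?case
    by (intro polynomial_functions.coord) (auto simp: coords_complex_prod_vec coords_complex_vec)
qed (rule polynomial_functions.intros; assumption)+

text \<open>The exponent bounds the degree of \<open>G\<close> in its first variable. This is what
  makes the ideal in the trick of Rabinowitsch absorb multiplication by polynomials that involve the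
  extra variable.\<close>

lemma clear_denominator:
  fixes G :: "complex \<times> (complex^'n) \<Rightarrow> complex"
  assumes f: "f \<in> Pol"
  shows "G \<in> Pol \<Longrightarrow> \<exists>m. \<exists>g\<in>Pol. \<forall>x. f x \<noteq> 0 \<longrightarrow> g x = f x ^ m * G (1 / f x, x)"
proof (induction rule: polynomial_functions.induct)
  case (const c)
  then show ?case by (intro exI[of _ 0] bexI[of _ "\<lambda>_. c"]) auto
next
  case (coord h)
  then consider "h = fst" | i where "h = (\<lambda>p. snd p $ i)" by (auto simp: coords_complex_prod_vec)
  then show ?case
  proof cases
    case 1
    then show ?thesis by (intro exI[of _ 1] bexI[of _ 1]) auto
  next
    case 2
    then show ?thesis by (intro exI[of _ 0] bexI[of _ "\<lambda>x. x $ i"]) auto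
  qed
next
  case (add F G)
  then obtain m g n h where g: "g \<in> Pol" "\<And>x. f x \<noteq> 0 \<Longrightarrow> g x = f x ^ m * F (1 / f x, x)"
    and h: "h \<in> Pol" "\<And>x. f x \<noteq> 0 \<Longrightarrow> h x = f x ^ n * G (1 / f x, x)" by blast
  then show ?case using f
    by (intro exI[of _ "m + n"] bexI[of _ "f ^ n * g + f ^ m * h"]) (auto simp: algebra_simps power_add)
next
  case (mult F G)
  then obtain m g n h where g: "g \<in> Pol" "\<And>x. f x \<noteq> 0 \<Longrightarrow> g x = f x ^ m * F (1 / f x, x)"
    and h: "h \<in> Pol" "\<And>x. f x \<noteq> 0 \<Longrightarrow> h x = f x ^ n * G (1 / f x, x)" by blast
  then show ?case
    by (intro exI[of _ "m + n"] bexI[of _ "g * h"]) (auto simp: algebra_simps power_add)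
qed

text \<open>Rabinowitsch's trick: the ideal \<open>J\<close> consists of the polynomials in \<open>(y, x)\<close> that fall into
  \<open>I\<close> when \<open>y\<close> is replaced by \<open>1/f(x)\<close> and denominators are cleared.\<close>

lemma nullstellensatz:
  fixes I :: "(complex^'n \<Rightarrow> complex) set"
  assumes I: "pideal I" and f: "f \<in> Pol" and van: "\<And>z. \<forall>g\<in>I. g z = 0 \<Longrightarrow> f z = 0"
  shows "\<exists>m. f ^ m \<in> I"
proof -
  define J where "J = {F \<in> Pol. \<exists>m. \<exists>h\<in>I. \<forall>x. f x \<noteq> 0 \<longrightarrow> h x = f x ^ m * F (1 / f x, x)}"
  have add: "F + G \<in> J" if "F \<in> J" "G \<in> J" for F G
  proof -
    obtain m g n h where g: "g \<in> I" "\<And>x. f x \<noteq> 0 \<Longrightarrow> g x = f x ^ m * F (1 / f x, x)"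
      and h: "h \<in> I" "\<And>x. f x \<noteq> 0 \<Longrightarrow> h x = f x ^ n * G (1 / f x, x)"
      using \<open>F \<in> J\<close> \<open>G \<in> J\<close> unfolding J_def by blast
    have "f ^ n * g + f ^ m * h \<in> I" using f g h by (intro pidealD[OF I]) auto
    moreover have "\<forall>x. f x \<noteq> 0 \<longrightarrow> (f ^ n * g + f ^ m * h) x = f x ^ (m + n) * (F + G) (1 / f x, x)"
      using g h by (auto simp: algebra_simps power_add)
    ultimately show ?thesis
      using that unfolding J_def by blast
  qed
  have mult: "G * F \<in> J" if F: "F \<in> J" and G: "G \<in> Pol" for F G
  proof -
    obtain n h where h: "h \<in> I" "\<And>x. f x \<noteq> 0 \<Longrightarrow> h x = f x ^ n * F (1 / f x, x)"
      using F unfolding J_def by blast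
    obtain m g where g: "g \<in> Pol" "\<And>x. f x \<noteq> 0 \<Longrightarrow> g x = f x ^ m * G (1 / f x, x)"
      using clear_denominator[OF f G] by blast
    have "g * h \<in> I" using g h by (intro pidealD[OF I]) auto
    moreover have "\<forall>x. f x \<noteq> 0 \<longrightarrow> (g * h) x = f x ^ (m + n) * (G * F) (1 / f x, x)"
      using g h by (auto simp: algebra_simps power_add)
    ultimately show ?thesis
      using that unfolding J_def by blast
  qed
  have zero: "0 \<in> J" using pidealD(2)[OF I] unfolding J_def
    by (auto intro!: bexI[of _ 0])
  have J: "pideal J" unfolding pideal_def using add mult zero by (auto simp: J_def)
  have 1: "(\<lambda>p. g (snd p)) \<in> J" if "g \<in> I" for g
    using that pidealD(1)[OF I] unfolding J_def
    by (auto intro!: Pol_snd exI[of _ 0] bexI[of _ g])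
  have fstP: "(fst :: complex \<times> (complex^'n) \<Rightarrow> complex) \<in> Pol"
    by (rule polynomial_functions.coord) (simp add: coords_complex_prod_vec)
  have 2: "1 - fst * (\<lambda>p. f (snd p)) \<in> J"
    using pidealD(2)[OF I] unfolding J_def
    by (auto intro!: Pol_snd fstP f bexI[of _ 0])
  have "1 \<in> J"
  proof (rule ccontr)
    assume "1 \<notin> J"
    moreover have "finite (coords :: (complex \<times> (complex^'n) \<Rightarrow> complex) set)"
      by (simp add: coords_complex_prod_vec)
    ultimately obtain \<kappa> where "\<And>z. (\<forall>x\<in>coords. x z = \<kappa> x) \<longrightarrow> (\<forall>f\<in>J. f z = 0)"
      using nullstellensatz_character J by blast
    from this[of "(\<kappa> fst, \<chi> i. \<kappa> (\<lambda>p. snd p $ i))"]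
    obtain z where z: "\<And>F. F \<in> J \<Longrightarrow> F z = 0"
      by (auto simp: coords_complex_prod_vec)
    \<comment> \<open>Elements of \<open>I\<close>, read as functions of the second component, lie
      in \<open>J\<close>. So \<open>z\<close> projects to a common zero of \<open>I\<close>, where
      \<open>f\<close> vanishes, while 1 - y f forces it not to.\<close>
    have "f (snd z) = 0" using van[of "snd z"] z[OF 1] by auto
    then show False using z[OF 2] by simp
  qed
  then obtain m h where h: "h \<in> I" "\<And>x. f x \<noteq> 0 \<Longrightarrow> h x = f x ^ m"
    unfolding J_def by auto
  \<comment> \<open>The equation for \<open>h\<close> is known only where \<open>f\<close> is
    nonzero; one more factor \<open>f\<close> makes both sides vanish elsewhere.\<close>
  have "f * h \<in> I" using pidealD(4)[OF I] f h by blast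
  moreover have "f * h = f ^ Suc m"
  proof
    fix x show "(f * h) x = (f ^ Suc m) x" using h(2)[of x] by (cases "f x = 0") auto
  qed
  ultimately show ?thesis by metis
qed

section \<open>Regular functions\<close>

lemma zariski_closed_Un:
  assumes "zariski_closed Z1" "zariski_closed Z2"
  shows "zariski_closed (Z1 \<union> Z2)"
proof -
  obtain S where S: "S \<subseteq> Pol" "Z1 = {x. \<forall>f\<in>S. f x = 0}"
    using assms unfolding zariski_closed_def by blast
  obtain T where T: "T \<subseteq> Pol" "Z2 = {x. \<forall>f\<in>T. f x = 0}"
    using assms unfolding zariski_closed_def by blast
  have "{f * g | f g. f \<in> S \<and> g \<in> T} \<subseteq> Pol" using S T by blast
  moreover have "Z1 \<union> Z2 = {x. \<forall>h\<in>{f * g | f g. f \<in> S \<and> g \<in> T}. h x = 0}"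
  proof
    show "Z1 \<union> Z2 \<subseteq> {x. \<forall>h\<in>{f * g | f g. f \<in> S \<and> g \<in> T}. h x = 0}"
      unfolding S T by auto
    show "{x. \<forall>h\<in>{f * g | f g. f \<in> S \<and> g \<in> T}. h x = 0} \<subseteq> Z1 \<union> Z2"
    proof
      fix x assume x: "x \<in> {x. \<forall>h\<in>{f * g | f g. f \<in> S \<and> g \<in> T}. h x = 0}"
      have "f x * g x = 0" if "f \<in> S" "g \<in> T" for f g
      proof -
        have "f * g \<in> {f * g | f g. f \<in> S \<and> g \<in> T}" using that by blast
        then have "(f * g) x = 0" using x by blast
        then show ?thesis by simp
      qed
      then show "x \<in> Z1 \<union> Z2" unfolding S T by auto
    qed
  qed
  ultimately show ?thesis unfolding zariski_closed_def by blast
qed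

lemma zariski_open_Int: "zariski_open W1 \<Longrightarrow> zariski_open W2 \<Longrightarrow> zariski_open (W1 \<inter> W2)"
  unfolding zariski_open_def by (simp add: zariski_closed_Un)

lemma zariski_open_UNIV: "zariski_open UNIV"
  unfolding zariski_open_def zariski_closed_def by (auto intro!: exI[of _ "{1}"])

lemma zariski_closed_zeros: "p \<in> Pol \<Longrightarrow> zariski_closed {x. p x = 0}"
  unfolding zariski_closed_def by (intro exI[of _ "{p}"]) auto

lemma regular_outside: "f \<in> regular_functions U \<Longrightarrow> x \<notin> U \<Longrightarrow> f x = 0"
  unfolding regular_functions_def by auto

lemma regularI:
  assumes "\<And>x. x \<notin> U \<Longrightarrow> f x = 0"
    and "\<And>x. x \<in> U \<Longrightarrow> \<exists>W p q. zariski_open W \<and> x \<in> W \<and> p \<in> Pol \<and> q \<in> Pol \<and>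
      (\<forall>y\<in>U \<inter> W. q y \<noteq> 0 \<and> f y = p y / q y)"
  shows "f \<in> regular_functions U"
  unfolding regular_functions_def
proof (intro CollectI conjI allI ballI impI)
  fix x assume "x \<in> U"
  from assms(2)[OF this] obtain W p q where W: "zariski_open W" "x \<in> W" "p \<in> Pol" "q \<in> Pol"
    "\<forall>y\<in>U \<inter> W. q y \<noteq> 0 \<and> f y = p y / q y" by (elim exE conjE)
  show "\<exists>W. zariski_open W \<and> x \<in> W \<and> (\<exists>p\<in>Pol. \<exists>q\<in>Pol. \<forall>y\<in>U \<inter> W. q y \<noteq> 0 \<and> f y = p y / q y)"
    by (intro exI[of _ W] conjI bexI[of _ p] bexI[of _ q] W)
qed (rule assms(1))

lemma regularD:
  assumes "f \<in> regular_functions U" "x \<in> U"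
  obtains W p q where "zariski_open W" "x \<in> W" "p \<in> Pol" "q \<in> Pol"
    "\<And>y. y \<in> U \<Longrightarrow> y \<in> W \<Longrightarrow> q y \<noteq> 0 \<and> f y = p y / q y"
  using assms unfolding regular_functions_def by blast

lemma regular_quotient:
  assumes "p \<in> Pol" "q \<in> Pol" "\<And>x. x \<in> U \<Longrightarrow> q x \<noteq> 0"
  shows "restr U (\<lambda>x. p x / q x) \<in> regular_functions U"
  by (rule regularI) (use assms zariski_open_UNIV in \<open>auto simp: restr_def\<close>)

lemma regular_restr_Pol: "p \<in> Pol \<Longrightarrow> restr U p \<in> regular_functions U"
  using regular_quotient[of p 1 U] by simp

lemma regular_add:
  assumes f: "f \<in> regular_functions U" and g: "g \<in> regular_functions U"
  shows "f + g \<in> regular_functions U"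
proof (rule regularI)
  fix x assume x: "x \<in> U"
  obtain W p q where W: "zariski_open W" "x \<in> W" "p \<in> Pol" "q \<in> Pol"
    "\<And>y. y \<in> U \<Longrightarrow> y \<in> W \<Longrightarrow> q y \<noteq> 0 \<and> f y = p y / q y" using regularD[OF f x] by blast
  obtain V r s where V: "zariski_open V" "x \<in> V" "r \<in> Pol" "s \<in> Pol"
    "\<And>y. y \<in> U \<Longrightarrow> y \<in> V \<Longrightarrow> s y \<noteq> 0 \<and> g y = r y / s y" using regularD[OF g x] by blast
  have "\<forall>y\<in>U \<inter> (W \<inter> V). (q * s) y \<noteq> 0 \<and> (f + g) y = (p * s + q * r) y / (q * s) y"
    using W V by (auto simp: field_simps)
  then show "\<exists>W p q. zariski_open W \<and> x \<in> W \<and> p \<in> Pol \<and> q \<in> Pol \<and>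
      (\<forall>y\<in>U \<inter> W. q y \<noteq> 0 \<and> (f + g) y = p y / q y)"
    using W(1-4) V(1-4)
    by (intro exI[of _ "W \<inter> V"] exI[of _ "(p * s + q * r)"] exI[of _ "q * s"] conjI zariski_open_Int Pol_mult Pol_add IntI)
qed (use assms in \<open>auto simp: regular_outside\<close>)

lemma regular_mult:
  assumes f: "f \<in> regular_functions U" and g: "g \<in> regular_functions U"
  shows "f * g \<in> regular_functions U"
proof (rule regularI)
  fix x assume x: "x \<in> U"
  obtain W p q where W: "zariski_open W" "x \<in> W" "p \<in> Pol" "q \<in> Pol"
    "\<And>y. y \<in> U \<Longrightarrow> y \<in> W \<Longrightarrow> q y \<noteq> 0 \<and> f y = p y / q y" using regularD[OF f x] by blast
  obtain V r s where V: "zariski_open V" "x \<in> V" "r \<in> Pol" "s \<in> Pol"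
    "\<And>y. y \<in> U \<Longrightarrow> y \<in> V \<Longrightarrow> s y \<noteq> 0 \<and> g y = r y / s y" using regularD[OF g x] by blast
  have "\<forall>y\<in>U \<inter> (W \<inter> V). (q * s) y \<noteq> 0 \<and> (f * g) y = (p * r) y / (q * s) y"
    using W V by (auto simp: field_simps)
  then show "\<exists>W p q. zariski_open W \<and> x \<in> W \<and> p \<in> Pol \<and> q \<in> Pol \<and>
      (\<forall>y\<in>U \<inter> W. q y \<noteq> 0 \<and> (f * g) y = p y / q y)"
    using W(1-4) V(1-4)
    by (intro exI[of _ "W \<inter> V"] exI[of _ "(p * r)"] exI[of _ "q * s"] conjI zariski_open_Int Pol_mult Pol_add IntI)
qed (use assms in \<open>auto simp: regular_outside\<close>)

lemma regular_scale:
  assumes "f \<in> regular_functions U"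
  shows "(\<lambda>x. c * f x) \<in> regular_functions U"
proof -
  have "restr U (\<lambda>_. c) * f = (\<lambda>x. c * f x)"
    using regular_outside[OF assms] by (auto simp: restr_def fun_eq_iff)
  then show ?thesis using regular_mult[OF regular_restr_Pol[of "\<lambda>_. c" U] assms] by simp
qed

lemma regular_zero [simp]: "0 \<in> regular_functions U"
proof -
  have "restr U (\<lambda>_. 0) = 0" by (auto simp: restr_def)
  then show ?thesis using regular_restr_Pol[of "\<lambda>_. 0" U] by simp
qed

lemma regular_uminus: "f \<in> regular_functions U \<Longrightarrow> - f \<in> regular_functions U"
  using regular_scale[of f U "-1"] by (simp add: fun_Compl_def)

lemma regular_power_mult:
  "a \<in> regular_functions U \<Longrightarrow> f \<in> regular_functions U \<Longrightarrow> a ^ m * f \<in> regular_functions U"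
  by (induction m) (auto simp: mult.assoc intro: regular_mult)

lemma regular_restr:
  assumes f: "f \<in> regular_functions X" and U: "U \<subseteq> X"
  shows "restr U f \<in> regular_functions U"
proof (rule regularI)
  fix x assume x: "x \<in> U"
  obtain W p q where W: "zariski_open W" "x \<in> W" "p \<in> Pol" "q \<in> Pol"
    "\<And>y. y \<in> X \<Longrightarrow> y \<in> W \<Longrightarrow> q y \<noteq> 0 \<and> f y = p y / q y" using regularD[OF f] U x by blast
  have "\<forall>y\<in>U \<inter> W. q y \<noteq> 0 \<and> restr U f y = p y / q y" using W(5) U by (auto simp: restr_def)
  then show "\<exists>W p q. zariski_open W \<and> x \<in> W \<and> p \<in> Pol \<and> q \<in> Pol \<and>
      (\<forall>y\<in>U \<inter> W. q y \<noteq> 0 \<and> restr U f y = p y / q y)" using W(1-4) by blast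
qed (auto simp: restr_def)

section \<open>Denominators on principal open sets\<close>

lemma zariski_closed_separate:
  assumes "zariski_closed Z" "x \<notin> Z"
  obtains s where "s \<in> Pol" "s x \<noteq> 0" "\<And>y. y \<in> Z \<Longrightarrow> s y = 0"
  using assms unfolding zariski_closed_def by blast

text \<open>The denominators of \<open>f\<close> form an ideal all of whose zeros lie on \<open>A = 0\<close>, so it contains a
  power of \<open>A\<close>.\<close>

lemma regular_on_principal_open:
  fixes X :: "(complex^'n) set"
  assumes X: "zariski_closed X" and A: "A \<in> Pol" and U: "U = {x\<in>X. A x \<noteq> 0}"
    and f: "f \<in> regular_functions U"
  shows "\<exists>m. \<exists>p\<in>Pol. \<forall>x\<in>U. A x ^ m * f x = p x"
proof -
  define I where "I = {q \<in> Pol. \<exists>p\<in>Pol. \<forall>x\<in>U. q x * f x = p x}"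
  have "f1 + f2 \<in> I" if "f1 \<in> I" "f2 \<in> I" for f1 f2
  proof -
    obtain p1 where p1: "p1 \<in> Pol" "\<forall>x\<in>U. f1 x * f x = p1 x"
      using \<open>f1 \<in> I\<close> unfolding I_def by auto
    obtain p2 where p2: "p2 \<in> Pol" "\<forall>x\<in>U. f2 x * f x = p2 x"
      using \<open>f2 \<in> I\<close> unfolding I_def by auto
    from p1 p2 show ?thesis using that unfolding I_def
      by (auto simp: algebra_simps intro!: bexI[of _ "p1 + p2"])
  qed
  moreover have "g * f1 \<in> I" if "f1 \<in> I" "g \<in> Pol" for f1 g
  proof -
    obtain p1 where "p1 \<in> Pol" "\<forall>x\<in>U. f1 x * f x = p1 x"
      using \<open>f1 \<in> I\<close> unfolding I_def by auto
    then show ?thesis using that unfolding I_def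
      by (auto simp: mult.assoc intro!: bexI[of _ "g * p1"])
  qed
  moreover have "0 \<in> I" unfolding I_def by (auto intro!: bexI[of _ 0])
  ultimately have I: "pideal I" unfolding pideal_def by (auto simp: I_def)
  have "\<exists>q\<in>I. q x \<noteq> 0" if Ax: "A x \<noteq> 0" for x
  proof (cases "x \<in> X")
    case False
    \<comment> \<open>A polynomial vanishing on \<open>X\<close> is a denominator with numerator 0,
      so the common zeros outside \<open>X\<close> disappear.\<close>
    then obtain s where s: "s \<in> Pol" "s x \<noteq> 0" "\<And>y. y \<in> X \<Longrightarrow> s y = 0"
      using zariski_closed_separate[OF X] by blast
    then have "s \<in> I" unfolding I_def U by (auto intro!: bexI[of _ 0])
    then show ?thesis using s by blast
  next
    case True
    then have "x \<in> U" using Ax U by simp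
    then obtain W p q where W: "zariski_open W" "x \<in> W" "p \<in> Pol" "q \<in> Pol"
      "\<And>y. y \<in> U \<Longrightarrow> y \<in> W \<Longrightarrow> q y \<noteq> 0 \<and> f y = p y / q y" using regularD[OF f] by blast
    obtain s where s: "s \<in> Pol" "s x \<noteq> 0" "\<And>y. y \<in> - W \<Longrightarrow> s y = 0"
      using zariski_closed_separate[of "- W" x] W by (auto simp: zariski_open_def)
    \<comment> \<open>The local denominator \<open>q\<close> becomes global after multiplication by
      \<open>s\<close>, which vanishes outside \<open>W\<close>.\<close>
    have "(s * q) y * f y = (s * p) y" if "y \<in> U" for y
      using s(3)[of y] W(5)[OF that] by (cases "y \<in> W") auto
    then have "s * q \<in> I" unfolding I_def using s W by blast
    moreover have "(s * q) x \<noteq> 0" using s W \<open>x \<in> U\<close> by auto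
    ultimately show ?thesis by blast
  qed
  then obtain m where "A ^ m \<in> I" using nullstellensatz[OF I A] by blast
  then show ?thesis unfolding I_def by auto
qed

text \<open>The case \<open>A = 1\<close>, in which the principal open set is all of
  \<open>X\<close>.\<close>

lemma regular_closed_Pol:
  fixes X :: "(complex^'n) set"
  assumes X: "zariski_closed X" and f: "f \<in> regular_functions X"
  obtains p where "p \<in> Pol" "f = restr X p"
proof -
  obtain m p where "p \<in> Pol" "\<forall>x\<in>X. 1 x ^ m * f x = p x"
    using regular_on_principal_open[OF X Pol_one _ f] by auto
  then have "f = restr X p" using regular_outside[OF f] by (auto simp: restr_def fun_eq_iff)
  then show thesis using that \<open>p \<in> Pol\<close> by blast
qed

text \<open>One factor \<open>a\<close> beyond the denominator makes the polynomial side vanish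
  where \<open>a\<close> does, in agreement with the extension of \<open>f\<close> by zero. All
  larger exponents are included so that the exponents of several functions can be made
  equal.\<close>

lemma regular_extend:
  fixes X :: "(complex^'n) set"
  assumes X: "zariski_closed X" and a: "a \<in> regular_functions X" and U: "U = {x\<in>X. a x \<noteq> 0}"
    and f: "f \<in> regular_functions U"
  shows "\<exists>m. \<forall>n\<ge>m. a ^ n * f \<in> regular_functions X"
proof -
  obtain A where A: "A \<in> Pol" "a = restr X A" using regular_closed_Pol[OF X a] by blast
  have U': "U = {x\<in>X. A x \<noteq> 0}" unfolding U A(2) by (auto simp: restr_def)
  obtain m p where p: "p \<in> Pol" "\<forall>x\<in>U. A x ^ m * f x = p x"
    using regular_on_principal_open[OF X A(1) U' f] by blast
  have "a ^ Suc m * f = restr X (A * p)"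
  proof
    fix x
    show "(a ^ Suc m * f) x = restr X (A * p) x"
      using p(2) regular_outside[OF f, of x] unfolding A(2) by (cases "x \<in> U") (auto simp: restr_def U')
  qed
  then have 1: "a ^ Suc m * f \<in> regular_functions X" using regular_restr_Pol A p by auto
  have "a ^ n * f \<in> regular_functions X" if "n \<ge> Suc m" for n
  proof -
    have "a ^ n * f = a ^ (n - Suc m) * (a ^ Suc m * f)"
      unfolding mult.assoc[symmetric] power_add[symmetric] using that by simp
    then show ?thesis using regular_power_mult[OF a 1] by simp
  qed
  then show ?thesis by blast
qed

lemma regular_divide:
  fixes X :: "(complex^'n) set"
  assumes X: "zariski_closed X" and a: "a \<in> regular_functions X" and U: "U = {x\<in>X. a x \<noteq> 0}"
    and f: "f \<in> regular_functions X"
  shows "restr U (\<lambda>x. f x / a x ^ m) \<in> regular_functions U"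
proof -
  obtain A where A: "A \<in> Pol" "a = restr X A" using regular_closed_Pol[OF X a] by blast
  obtain p where p: "p \<in> Pol" "f = restr X p" using regular_closed_Pol[OF X f] by blast
  have "restr U (\<lambda>x. f x / a x ^ m) = restr U (\<lambda>x. p x / (A ^ m) x)"
    unfolding A(2) p(2) U by (auto simp: restr_def)
  moreover have "(A ^ m) x \<noteq> 0" if "x \<in> U" for x using that unfolding U A(2) by (auto simp: restr_def)
  ultimately show ?thesis using regular_quotient[of p "A ^ m" U] A p by auto
qed

section \<open>Zero divisors and partitions of unity\<close>

lemma regular_mult_nonzero:
  fixes X :: "(complex^'n) set"
  assumes X: "affine_variety X" and f: "f \<in> regular_functions X" "f \<noteq> 0"
    and g: "g \<in> regular_functions X" "g \<noteq> 0"
  shows "f * g \<noteq> 0"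
proof
  assume 0: "f * g = 0"
  have cl: "zariski_closed X" and irr: "zariski_irreducible X" using X by (auto simp: affine_variety_def)
  obtain p where p: "p \<in> Pol" "f = restr X p" using regular_closed_Pol[OF cl f(1)] by blast
  obtain q where q: "q \<in> Pol" "g = restr X q" using regular_closed_Pol[OF cl g(1)] by blast
  have "p x = 0 \<or> q x = 0" if "x \<in> X" for x
    using fun_cong[OF 0, of x] that by (auto simp: p q restr_def)
  then have "X \<subseteq> {x. p x = 0} \<union> {x. q x = 0}" by blast
  then have "X \<subseteq> {x. p x = 0} \<or> X \<subseteq> {x. q x = 0}"
    using irr zariski_closed_zeros p q unfolding zariski_irreducible_def by blast
  then have "f = 0 \<or> g = 0" unfolding p q by (auto simp: restr_def fun_eq_iff)
  then show False using f g by blast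
qed

lemma restr_one_nonzero:
  assumes "affine_variety X"
  shows "restr X (\<lambda>_. 1) \<noteq> 0"
proof -
  obtain x where "x \<in> X" using assms by (auto simp: affine_variety_def zariski_irreducible_def)
  then have "restr X (\<lambda>_. 1) x = 1" by (simp add: restr_def)
  then show ?thesis by force
qed

text \<open>The polynomials that on \<open>B\<close> are combinations of the powers form an ideal.
  Those vanishing on \<open>B\<close> belong to it and exclude zeros off \<open>B\<close>; on
  \<open>B\<close> some power is nonzero, since \<open>a i ^ m i\<close> has no zeros beyond those
  of \<open>a i\<close>. The exponents may therefore be arbitrary.\<close>

lemma regular_partition_of_unity:
  fixes B :: "(complex^'m) set"
  assumes B: "zariski_closed B" and K: "finite K" and a: "\<And>i. i \<in> K \<Longrightarrow> a i \<in> regular_functions B"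
    and nz: "\<not> (\<exists>b\<in>B. \<forall>i\<in>K. a i b = 0)"
  obtains \<beta> where "\<And>i. i \<in> K \<Longrightarrow> \<beta> i \<in> regular_functions B"
    "\<And>b. b \<in> B \<Longrightarrow> (\<Sum>i\<in>K. \<beta> i b * a i b ^ m i) = 1"
proof -
  have "\<exists>A\<in>Pol. a i = restr B A" if "i \<in> K" for i
    using regular_closed_Pol[OF B a[OF that]] by blast
  then obtain A where A: "\<And>i. i \<in> K \<Longrightarrow> A i \<in> Pol" "\<And>i. i \<in> K \<Longrightarrow> a i = restr B (A i)" by metis
  define I where "I = {h\<in>Pol. \<exists>\<beta>. (\<forall>i\<in>K. \<beta> i \<in> Pol) \<and> (\<forall>b\<in>B. h b = (\<Sum>i\<in>K. \<beta> i b * A i b ^ m i))}"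
  have "f + g \<in> I" if fg: "f \<in> I" "g \<in> I" for f g
  proof -
    obtain \<beta> \<gamma> where "\<forall>i\<in>K. \<beta> i \<in> Pol" "\<forall>b\<in>B. f b = (\<Sum>i\<in>K. \<beta> i b * A i b ^ m i)"
      "\<forall>i\<in>K. \<gamma> i \<in> Pol" "\<forall>b\<in>B. g b = (\<Sum>i\<in>K. \<gamma> i b * A i b ^ m i)"
      using fg unfolding I_def by blast
    then show ?thesis using fg unfolding I_def
      by (auto simp: algebra_simps sum.distrib intro!: exI[of _ "\<lambda>i. \<beta> i + \<gamma> i"])
  qed
  moreover have "g * f \<in> I" if fg: "f \<in> I" "g \<in> Pol" for f g
  proof -
    obtain \<beta> where "\<forall>i\<in>K. \<beta> i \<in> Pol" "\<forall>b\<in>B. f b = (\<Sum>i\<in>K. \<beta> i b * A i b ^ m i)"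
      using fg unfolding I_def by blast
    then show ?thesis using fg unfolding I_def
      by (auto simp: algebra_simps sum_distrib_left intro!: exI[of _ "\<lambda>i. g * \<beta> i"])
  qed
  moreover have "0 \<in> I" unfolding I_def by (auto intro!: exI[of _ "\<lambda>_. 0"])
  ultimately have I: "pideal I" unfolding pideal_def by (auto simp: I_def)
  have "\<exists>f\<in>I. f z \<noteq> 0" for z
  proof (cases "z \<in> B")
    case False
    then obtain s where s: "s \<in> Pol" "s z \<noteq> 0" "\<And>y. y \<in> B \<Longrightarrow> s y = 0"
      using zariski_closed_separate[OF B] by blast
    then have "s \<in> I" unfolding I_def by (auto intro!: exI[of _ "\<lambda>_. 0"])
    then show ?thesis using s by blast
  next
    case True
    then obtain j where j: "j \<in> K" "a j z \<noteq> 0" using nz by blast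
    have "A j ^ m j \<in> I"
    proof -
      have "(\<Sum>i\<in>K. (if i = j then 1 else 0) b * A i b ^ m i) = A j b ^ m j" for b
      proof -
        have "(\<Sum>i\<in>K. (if i = j then 1 else 0) b * A i b ^ m i) = (\<Sum>i\<in>K. if i = j then A i b ^ m i else 0)"
          by (intro sum.cong) auto
        then show ?thesis using K j by simp
      qed
      then show ?thesis unfolding I_def using A j by (auto intro!: exI[of _ "\<lambda>i. if i = j then 1 else 0"])
    qed
    moreover have "(A j ^ m j) z \<noteq> 0" using j A(2)[of j] True by (auto simp: restr_def)
    ultimately show ?thesis by blast
  qed
  then have "1 \<in> I" using weak_nullstellensatz[OF I] by blast
  then obtain \<beta> where \<beta>: "\<forall>i\<in>K. \<beta> i \<in> Pol" "\<forall>b\<in>B. 1 = (\<Sum>i\<in>K. \<beta> i b * A i b ^ m i)"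
    unfolding I_def by auto
  show thesis
  proof (rule that[of "\<lambda>i. restr B (\<beta> i)"])
    show "restr B (\<beta> i) \<in> regular_functions B" if "i \<in> K" for i
      using \<beta> that regular_restr_Pol by blast
    show "(\<Sum>i\<in>K. restr B (\<beta> i) b * a i b ^ m i) = 1" if "b \<in> B" for b
      using \<beta>(2) A(2) that by (simp add: restr_def)
  qed
qed

lemma cring_coordinate_ring: "cring (coordinate_ring U)"
proof (rule cringI)
  show "abelian_group (coordinate_ring U)"
  proof (rule abelian_groupI)
    fix f assume "f \<in> carrier (coordinate_ring U)"
    then show "\<exists>g\<in>carrier (coordinate_ring U). g \<oplus>\<^bsub>coordinate_ring U\<^esub> f = \<zero>\<^bsub>coordinate_ring U\<^esub>"
      by (auto simp: coordinate_ring_def intro!: bexI[of _ "- f"] regular_uminus)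
  qed (auto simp: coordinate_ring_def algebra_simps intro: regular_add)
  show "comm_monoid (coordinate_ring U)"
    by (rule comm_monoidI) (auto simp: coordinate_ring_def algebra_simps restr_def fun_eq_iff regular_outside
      intro: regular_mult regular_restr_Pol[unfolded restr_def])
qed (auto simp: coordinate_ring_def algebra_simps)

section \<open>Restriction of vector fields to principal open subsets\<close>

lemma vector_fieldsI:
  assumes "\<And>f. f \<notin> regular_functions U \<Longrightarrow> D f = 0"
    and "\<And>f. f \<in> regular_functions U \<Longrightarrow> D f \<in> regular_functions U"
    and "\<And>f g. f \<in> regular_functions U \<Longrightarrow> g \<in> regular_functions U \<Longrightarrow> D (f + g) = D f + D g"
    and "\<And>c f. f \<in> regular_functions U \<Longrightarrow> D (\<lambda>x. c * f x) = (\<lambda>x. c * D f x)"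
    and "\<And>f g. f \<in> regular_functions U \<Longrightarrow> g \<in> regular_functions U \<Longrightarrow>
      D (f * g) = f * D g + g * D f"
  shows "D \<in> vector_fields U"
  using assms unfolding vector_fields_def by simp

context
  fixes U :: "'a::affine_space set" and D
  assumes D: "D \<in> vector_fields U"
begin

lemma vf_outside: "f \<notin> regular_functions U \<Longrightarrow> D f = 0"
  using D unfolding vector_fields_def by simp

lemma vf_add: "f \<in> regular_functions U \<Longrightarrow> g \<in> regular_functions U \<Longrightarrow> D (f + g) = D f + D g"
  using D unfolding vector_fields_def by simp

lemma vf_scale: "f \<in> regular_functions U \<Longrightarrow> D (\<lambda>x. c * f x) = (\<lambda>x. c * D f x)"
  using D unfolding vector_fields_def by simp

lemma vf_mult:
  "f \<in> regular_functions U \<Longrightarrow> g \<in> regular_functions U \<Longrightarrow> D (f * g) = f * D g + g * D f"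
  using D unfolding vector_fields_def by simp

lemma vf_regular: "D f \<in> regular_functions U"
proof (cases "f \<in> regular_functions U")
  case True
  then show ?thesis using D unfolding vector_fields_def by simp
qed (simp add: vf_outside)

lemma vf_zero: "D 0 = 0"
  using vf_add[of 0 0] by simp

lemma vf_smult:
  assumes g: "g \<in> regular_functions U"
  shows "(\<lambda>h. g * D h) \<in> vector_fields U"
  by (rule vector_fieldsI)
    (use g in \<open>auto simp: vf_outside vf_add vf_scale vf_mult algebra_simps fun_eq_iff
      intro: regular_mult vf_regular\<close>)

lemma Ker_mult: "f \<in> Ker U D \<Longrightarrow> g \<in> Ker U D \<Longrightarrow> f * g \<in> Ker U D"
  by (auto simp: Ker_def vf_mult regular_mult)

lemma vf_Ker_mult: "a \<in> Ker U D \<Longrightarrow> f \<in> regular_functions U \<Longrightarrow> D (a * f) = a * D f"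
  by (simp add: Ker_def vf_mult)

lemma vf_Ker_power_mult:
  assumes a: "a \<in> Ker U D" and f: "f \<in> regular_functions U"
  shows "D (a ^ m * f) = a ^ m * D f"
proof (induction m)
  case (Suc m)
  have "a ^ m * f \<in> regular_functions U" using a f regular_power_mult unfolding Ker_def by blast
  then show ?case using vf_Ker_mult[OF a, of "a ^ m * f"] Suc by (simp only: power_Suc mult.assoc)
qed simp

end

context
  fixes X U :: "(complex^'n) set" and D a
  assumes X: "zariski_closed X" and D: "D \<in> vector_fields X" and a: "a \<in> Ker X D"
    and U: "U = {x\<in>X. a x \<noteq> 0}"
begin

lemma defining_function_regular: "a \<in> regular_functions X"
  using a by (simp add: Ker_def)

lemma restr_power_mult:
  assumes "f \<in> regular_functions U"
  shows "restr U a ^ n * f = a ^ n * f" "restr U (a ^ n * f) = a ^ n * f"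
  using regular_outside[OF assms] by (auto simp: fun_eq_iff restr_def)

text \<open>Since \<open>D a = 0\<close>, the quotient rule reduces to dividing by the same power of
  \<open>a\<close> before and after applying \<open>D\<close>.\<close>

lemma restrict_field_exists:
  "\<exists>D'. D' \<in> vector_fields U \<and> (\<forall>f\<in>regular_functions X. D' (restr U f) = restr U (D f))"
proof -
  have "\<exists>m. \<forall>n\<ge>m. a ^ n * f \<in> regular_functions X" if "f \<in> regular_functions U" for f
    using regular_extend[OF X defining_function_regular U that] .
  then obtain N where N: "\<And>f n. f \<in> regular_functions U \<Longrightarrow> n \<ge> N f \<Longrightarrow> a ^ n * f \<in> regular_functions X"
    by metis
  define D' where "D' = (\<lambda>f. if f \<in> regular_functions U
    then restr U (\<lambda>x. D (a ^ N f * f) x / a x ^ N f) else 0)"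
  \<comment> \<open>Independence of the exponent, so that the laws of a derivation can be checked
    with a common one.\<close>
  have D'_eq: "D' f = restr U (\<lambda>x. D (a ^ n * f) x / a x ^ n)"
    if f: "f \<in> regular_functions U" and n: "a ^ n * f \<in> regular_functions X" for f n
  proof -
    have "a ^ n * D (a ^ N f * f) = D (a ^ n * (a ^ N f * f))"
      using vf_Ker_power_mult[OF D a N[OF f order_refl], of n] by simp
    also have "\<dots> = D (a ^ N f * (a ^ n * f))" by (simp add: algebra_simps)
    also have "\<dots> = a ^ N f * D (a ^ n * f)"
      using vf_Ker_power_mult[OF D a n, of "N f"] by simp
    finally have "(a ^ n * D (a ^ N f * f)) x = (a ^ N f * D (a ^ n * f)) x" for x by simp
    then show ?thesis using f unfolding D'_def U by (auto simp: restr_def fun_eq_iff field_simps)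
  qed
  have "D' \<in> vector_fields U"
  proof (rule vector_fieldsI)
    fix f assume f: "f \<in> regular_functions U"
    then show "D' f \<in> regular_functions U"
      unfolding D'_def using regular_divide[OF X defining_function_regular U vf_regular[OF D]] by simp
    show "D' (\<lambda>x. c * f x) = (\<lambda>x. c * D' f x)" for c
    proof -
      have fX: "a ^ N f * f \<in> regular_functions X" by (rule N[OF f order_refl])
      have eq: "a ^ N f * (\<lambda>x. c * f x) = (\<lambda>x. c * (a ^ N f * f) x)" by (auto simp: fun_eq_iff)
      have "a ^ N f * (\<lambda>x. c * f x) \<in> regular_functions X" unfolding eq by (rule regular_scale[OF fX])
      from D'_eq[OF regular_scale[OF f] this] show ?thesis
        unfolding D'_eq[OF f fX] unfolding eq vf_scale[OF D fX] by (auto simp: restr_def)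
    qed
    fix g assume g: "g \<in> regular_functions U"
    define n where "n = N f + N g"
    have fn: "a ^ n * f \<in> regular_functions X" and gn: "a ^ n * g \<in> regular_functions X"
      using N f g by (auto simp: n_def)
    have eq: "a ^ n * (f + g) = a ^ n * f + a ^ n * g" by (simp add: algebra_simps)
    have "a ^ n * (f + g) \<in> regular_functions X" unfolding eq by (rule regular_add[OF fn gn])
    from D'_eq[OF regular_add[OF f g] this] show "D' (f + g) = D' f + D' g"
      unfolding D'_eq[OF f fn] D'_eq[OF g gn] unfolding eq vf_add[OF D fn gn]
      by (auto simp: restr_def add_divide_distrib)
    have eq: "a ^ (n + n) * (f * g) = (a ^ n * f) * (a ^ n * g)"
      by (simp add: algebra_simps power_add)
    have "a ^ (n + n) * (f * g) \<in> regular_functions X" unfolding eq by (rule regular_mult[OF fn gn])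
    from D'_eq[OF regular_mult[OF f g] this] show "D' (f * g) = f * D' g + g * D' f"
      unfolding D'_eq[OF f fn] D'_eq[OF g gn] unfolding eq vf_mult[OF D fn gn]
      by (auto simp: restr_def U fun_eq_iff field_simps power_add)
  qed (simp add: D'_def)
  moreover have "D' (restr U f) = restr U (D f)" if f: "f \<in> regular_functions X" for f
  proof -
    have r: "restr U f \<in> regular_functions U" using regular_restr[OF f] U by auto
    \<comment> \<open>The exponent 1 and not 0: \<open>f\<close> and \<open>restr U f\<close> may
      differ on the zero locus of \<open>a\<close>, and one factor \<open>a\<close> removes the
      difference.\<close>
    have eq: "a ^ 1 * restr U f = a ^ 1 * f"
      using regular_outside[OF f] by (auto simp: U restr_def fun_eq_iff)
    have "a ^ 1 * restr U f \<in> regular_functions X"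
      unfolding eq by (rule regular_power_mult[OF defining_function_regular f])
    from D'_eq[OF r this] show ?thesis
      unfolding eq vf_Ker_power_mult[OF D a f] by (auto simp: restr_def U)
  qed
  ultimately show ?thesis by blast
qed

text \<open>The restriction of \<open>a\<close> lies in the kernel of every extension
  \<open>D'\<close>, so \<open>a ^ n\<close> passes through \<open>D'\<close> and \<open>f\<close>
  is reduced to a function coming from \<open>X\<close>. This yields both uniqueness and a formula
  for computing with the restricted field.\<close>

lemma extension_determined:
  assumes D': "D' \<in> vector_fields U" "\<And>f. f \<in> regular_functions X \<Longrightarrow> D' (restr U f) = restr U (D f)"
    and f: "f \<in> regular_functions U" and n: "a ^ n * f \<in> regular_functions X"
  shows "restr U (D (a ^ n * f)) = a ^ n * D' f"
proof -
  have "D a = 0" using a by (simp add: Ker_def)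
  then have "D' (restr U a) = 0" using D'(2)[OF defining_function_regular] by (auto simp: restr_def)
  then have "restr U a \<in> Ker U D'" using regular_restr[OF defining_function_regular, of U] U by (auto simp: Ker_def)
  then have "D' (restr U a ^ n * f) = restr U a ^ n * D' f" by (rule vf_Ker_power_mult[OF D'(1) _ f])
  then have "D' (a ^ n * f) = a ^ n * D' f"
    using restr_power_mult(1)[OF f] restr_power_mult(1)[OF vf_regular[OF D'(1)]] by simp
  moreover have "D' (restr U (a ^ n * f)) = restr U (D (a ^ n * f))" by (rule D'(2)[OF n])
  ultimately show ?thesis using restr_power_mult(2)[OF f] by simp
qed

text \<open>Existence and uniqueness justify the definite description. Two extensions agree on
  \<open>U\<close> because \<open>a\<close> has no zeros there, and off \<open>U\<close> because all
  values are extended by zero.\<close>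

lemma restrict_field:
  "restrict_field X U D \<in> vector_fields U"
  "f \<in> regular_functions X \<Longrightarrow> restrict_field X U D (restr U f) = restr U (D f)"
proof -
  let ?P = "\<lambda>D'. D' \<in> vector_fields U \<and> (\<forall>f\<in>regular_functions X. D' (restr U f) = restr U (D f))"
  have uniq: "E = F" if E: "?P E" and F: "?P F" for E F
  proof
    fix f
    show "E f = F f"
    proof (cases "f \<in> regular_functions U")
      case False
      then show ?thesis using vf_outside E F by metis
    next
      case True
      obtain n where n: "a ^ n * f \<in> regular_functions X"
        using regular_extend[OF X defining_function_regular U True] by blast
      have "a ^ n * E f = a ^ n * F f"
        using extension_determined[of E, OF _ _ True n] extension_determined[of F, OF _ _ True n] E F by simp
      then have eq: "a x ^ n * E f x = a x ^ n * F f x" for x by (metis power_fun_apply times_fun_apply)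
      show ?thesis
      proof
        fix x
        show "E f x = F f x"
        proof (cases "x \<in> U")
          case True
          then show ?thesis using eq[of x] by (simp add: U)
        next
          case False
          then show ?thesis
            using regular_outside vf_regular E F by metis
        qed
      qed
    qed
  qed
  have "\<exists>!D'. ?P D'" using restrict_field_exists uniq by blast
  from theI'[OF this] have "?P (restrict_field X U D)" unfolding restrict_field_def .
  then show "restrict_field X U D \<in> vector_fields U"
    "f \<in> regular_functions X \<Longrightarrow> restrict_field X U D (restr U f) = restr U (D f)" by blast+
qed

lemma restrict_field_power_mult:
  assumes "f \<in> regular_functions U" "a ^ n * f \<in> regular_functions X"
  shows "restr U (D (a ^ n * f)) = a ^ n * restrict_field X U D f"
  using extension_determined[OF restrict_field assms] .

text \<open>Once the denominator is cleared, the derivative is known to vanish only on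
  \<open>U\<close>; one more factor \<open>a\<close> kills it on the zero locus of
  \<open>a\<close>.\<close>

lemma Ker_restrict_field_extend:
  assumes f: "f \<in> Ker U (restrict_field X U D)"
  shows "\<exists>m. \<forall>n\<ge>m. a ^ n * f \<in> Ker X D"
proof -
  have fU: "f \<in> regular_functions U" and f0: "restrict_field X U D f = 0"
    using f by (auto simp: Ker_def)
  obtain m where m: "\<And>n. n \<ge> m \<Longrightarrow> a ^ n * f \<in> regular_functions X"
    using regular_extend[OF X defining_function_regular U fU] by blast
  have "a ^ n * f \<in> Ker X D" if n: "n \<ge> Suc m" for n
  proof -
    obtain k where k: "n = Suc k" "k \<ge> m" using n by (cases n) auto
    have "restr U (D (a ^ k * f)) = 0"
      using restrict_field_power_mult[OF fU m[OF k(2)]] f0 by simp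
    then have "D (a ^ k * f) x = 0" if "x \<in> U" for x
      using that by (auto simp: restr_def fun_eq_iff split: if_splits)
    moreover have "D (a ^ k * f) x = 0" if "x \<notin> X" for x
      using that regular_outside vf_regular[OF D] by blast
    ultimately have "a * D (a ^ k * f) = 0" by (auto simp: U fun_eq_iff)
    moreover have "D (a ^ n * f) = a * D (a ^ k * f)"
      using vf_Ker_mult[OF D a m[OF k(2)]] by (simp add: k mult.assoc)
    ultimately show ?thesis using m[of n] n by (simp add: Ker_def)
  qed
  then show ?thesis by blast
qed

end

section \<open>Complete vector fields\<close>

text \<open>The pointwise condition inside \<open>holomorphic_fun_on\<close>. Homogeneity over the
  complex numbers is all that has to be demanded, as \<open>has_derivative\<close> already includes
  additivity.\<close>

definition holo_at :: "(complex \<times> (complex^'n) \<Rightarrow> complex) \<Rightarrow> complex \<times> (complex^'n) \<Rightarrow> bool" where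
  "holo_at G z \<longleftrightarrow> (\<exists>G'. (G has_derivative G') (at z) \<and> (\<forall>c s v. G' (c * s, c *s v) = c * G' (s, v)))"

lemma holo_at_const: "holo_at (\<lambda>_. c) z"
  unfolding holo_at_def by (intro exI[of _ "\<lambda>_. 0"]) auto

lemma holo_at_fst: "holo_at fst z"
  unfolding holo_at_def by (intro exI[of _ fst]) (auto intro: derivative_intros)

lemma holo_at_snd_nth:
  fixes z :: "complex \<times> (complex^'n)"
  shows "holo_at (\<lambda>p. snd p $ i) z"
proof -
  have "bounded_linear (\<lambda>p :: complex \<times> (complex^'n). snd p $ i)"
    using bounded_linear_compose[OF bounded_linear_vec_nth bounded_linear_snd] .
  then show ?thesis
    unfolding holo_at_def
    by (intro exI[of _ "\<lambda>p. snd p $ i"]) (auto intro: bounded_linear_imp_has_derivative)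
qed

lemma holo_at_add:
  assumes "holo_at f z" "holo_at g z"
  shows "holo_at (\<lambda>x. f x + g x) z"
proof -
  obtain f' g' where "(f has_derivative f') (at z)" "\<And>c s v. f' (c * s, c *s v) = c * f' (s, v)"
    "(g has_derivative g') (at z)" "\<And>c s v. g' (c * s, c *s v) = c * g' (s, v)"
    using assms unfolding holo_at_def by blast
  then show ?thesis unfolding holo_at_def
    by (intro exI[of _ "\<lambda>h. f' h + g' h"]) (auto intro: has_derivative_add simp: algebra_simps)
qed

lemma holo_at_mult:
  assumes "holo_at f z" "holo_at g z"
  shows "holo_at (\<lambda>x. f x * g x) z"
proof -
  obtain f' g' where "(f has_derivative f') (at z)" "\<And>c s v. f' (c * s, c *s v) = c * f' (s, v)"
    "(g has_derivative g') (at z)" "\<And>c s v. g' (c * s, c *s v) = c * g' (s, v)"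
    using assms unfolding holo_at_def by blast
  then show ?thesis unfolding holo_at_def
    by (intro exI[of _ "\<lambda>h. f z * g' h + f' h * g z"]) (auto intro: has_derivative_mult simp: algebra_simps)
qed

lemma holo_at_compose:
  assumes "holo_at f z" "(e has_field_derivative d) (at (f z))"
  shows "holo_at (\<lambda>x. e (f x)) z"
proof -
  obtain f' where "(f has_derivative f') (at z)" "\<And>c s v. f' (c * s, c *s v) = c * f' (s, v)"
    using assms unfolding holo_at_def by blast
  then show ?thesis unfolding holo_at_def
    using has_derivative_compose[of f f' z UNIV e "(*) d"] assms(2)
    by (intro exI[of _ "\<lambda>h. d * f' h"]) (auto simp: has_field_derivative_def)
qed

lemma holo_at_Pol: "p \<in> Pol \<Longrightarrow> holo_at (\<lambda>z. p (snd z)) z"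
proof (induction rule: polynomial_functions.induct)
  case (const c)
  show ?case by (rule holo_at_const)
next
  case (coord f)
  then show ?case by (auto simp: coords_complex_vec intro: holo_at_snd_nth)
qed (rule holo_at_add holo_at_mult; assumption)+

text \<open>The inner map changes the time and keeps the point, which is how the flow of u D arises
  from that of D.\<close>

lemma holo_at_compose_fst:
  assumes T: "holo_at T z" and G: "holo_at G (T z, snd z)"
  shows "holo_at (\<lambda>z. G (T z, snd z)) z"
proof -
  obtain T' where T': "(T has_derivative T') (at z)" "\<And>c s v. T' (c * s, c *s v) = c * T' (s, v)"
    using T unfolding holo_at_def by blast
  obtain G' where G': "(G has_derivative G') (at (T z, snd z))"
    "\<And>c s v. G' (c * s, c *s v) = c * G' (s, v)"
    using G unfolding holo_at_def by blast
  have "((\<lambda>z. (T z, snd z)) has_derivative (\<lambda>h. (T' h, snd h))) (at z)"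
    by (intro derivative_intros T')
  from has_derivative_compose[OF this G'(1)] show ?thesis
    unfolding holo_at_def by (intro exI[of _ "\<lambda>h. G' (T' h, snd h)"]) (auto simp: T' G')
qed

lemma holo_at_imp_continuous: "holo_at f z \<Longrightarrow> isCont f z"
  unfolding holo_at_def using has_derivative_continuous by blast

text \<open>The function (e^z - 1)/z with its removable singularity filled. Then
  \<open>t * expquot (t * b)\<close> is the solution of s' = 1 + b s, s(0) = 0, also for
  \<open>b = 0\<close>.\<close>

definition expquot :: "complex \<Rightarrow> complex" where
  "expquot z = (if z = 0 then 1 else (exp z - 1) / z)"

lemma expquot_differentiable: "\<exists>d. (expquot has_field_derivative d) (at z)"
proof -
  have "(\<lambda>z. if z = 0 then deriv exp 0 else (exp z - exp 0) / (z - (0::complex))) holomorphic_on UNIV"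
    by (rule pole_lemma_open) (auto intro: holomorphic_intros)
  moreover have "deriv exp (0::complex) = exp 0" by (rule DERIV_imp_deriv[OF DERIV_exp])
  ultimately have "expquot holomorphic_on UNIV"
    unfolding expquot_def by (simp only: exp_zero diff_zero)
  then show ?thesis
    by (simp add: holomorphic_on_def field_differentiable_def)
qed

text \<open>The additivity of the changed time: after time \<open>t\<close> the factor
  \<open>u\<close> has grown by \<open>exp (t * b)\<close>, so the next stretch of length
  \<open>s\<close> is scaled by it. Multiplication by a nonzero \<open>b\<close> removes the
  quotients.\<close>

lemma expquot_cocycle:
  "(s + t) * expquot ((s + t) * b) = exp (t * b) * (s * expquot (s * b)) + t * expquot (t * b)"
proof -
  have *: "b * (t * expquot (t * b)) = exp (t * b) - 1" for t
    by (auto simp: expquot_def)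
  show ?thesis
  proof (cases "b = 0")
    case False
    have "b * ((s + t) * expquot ((s + t) * b)) = b * (exp (t * b) * (s * expquot (s * b)) + t * expquot (t * b))"
    proof -
      have "b * (exp (t * b) * (s * expquot (s * b)) + t * expquot (t * b))
          = exp (t * b) * (b * (s * expquot (s * b))) + b * (t * expquot (t * b))"
        by (simp add: algebra_simps)
      also have "\<dots> = exp (t * b) * (exp (s * b) - 1) + (exp (t * b) - 1)" unfolding * ..
      also have "\<dots> = exp ((s + t) * b) - 1" by (simp add: algebra_simps exp_add)
      finally show ?thesis unfolding * ..
    qed
    then show ?thesis using False by simp
  qed (simp add: expquot_def)
qed

section \<open>Regular functions along a flow\<close>

context
  fixes U :: "(complex^'n) set" and D \<Phi>
  assumes flow: "phase_flow U D \<Phi>"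
begin

lemma flow_in: "x \<in> U \<Longrightarrow> \<Phi> t x \<in> U"
  and flow_zero: "x \<in> U \<Longrightarrow> \<Phi> 0 x = x"
  and flow_plus: "x \<in> U \<Longrightarrow> \<Phi> (s + t) x = \<Phi> s (\<Phi> t x)"
  using flow unfolding phase_flow_def holomorphic_action_def by auto

text \<open>The group law carries the derivative from time 0, where the definition provides it, to
  every time.\<close>

lemma flow_deriv:
  assumes f: "f \<in> regular_functions U" and x: "x \<in> U"
  shows "((\<lambda>t. f (\<Phi> t x)) has_field_derivative D f (\<Phi> t x)) (at t)"
proof -
  have "((\<lambda>s. f (\<Phi> s (\<Phi> t x))) has_field_derivative D f (\<Phi> t x)) (at 0)"
    using flow f flow_in[OF x] unfolding phase_flow_def by blast
  then have "((\<lambda>s. f (\<Phi> (s + t) x)) has_field_derivative D f (\<Phi> t x)) (at 0)"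
    using flow_plus[OF x] by simp
  then show ?thesis using DERIV_shift[of "\<lambda>t. f (\<Phi> t x)" _ 0 t] by simp
qed

lemma flow_Ker:
  assumes f: "f \<in> regular_functions U" "D f = 0" and x: "x \<in> U"
  shows "f (\<Phi> t x) = f x"
proof -
  have "\<exists>c. \<forall>t\<in>UNIV. f (\<Phi> t x) = c"
    using flow_deriv[OF f(1) x] f(2)
    by (intro has_field_derivative_zero_constant) auto
  then obtain c where c: "f (\<Phi> t x) = c" for t by blast
  show ?thesis using c[of t] c[of 0] flow_zero[OF x] by simp
qed

lemma flow_affine:
  assumes D: "D \<in> vector_fields U"
    and u: "u \<in> regular_functions U" "D (D u) = 0" and x: "x \<in> U"
  shows "u (\<Phi> t x) = u x + t * D u x"
proof -
  have "((\<lambda>t. u (\<Phi> t x) - t * D u x) has_field_derivative 0) (at t)" for t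
    using flow_Ker[OF vf_regular[OF D] u(2) x]
    by (auto intro!: derivative_eq_intros flow_deriv[OF u(1) x])
  then have "\<exists>c. \<forall>t\<in>UNIV. u (\<Phi> t x) - t * D u x = c"
    by (intro has_field_derivative_zero_constant) auto
  then obtain c where c: "u (\<Phi> t x) - t * D u x = c" for t by blast
  show ?thesis using c[of t] c[of 0] flow_zero[OF x] by (simp add: algebra_simps)
qed

end

text \<open>With \<open>b = D u\<close> constant along the flow of \<open>D\<close>, the field \<open>u D\<close> moves along the same
  trajectories with the time change \<open>\<tau>\<close> solving \<open>d\<tau>/dt = u + b \<tau>\<close>.\<close>

lemma complete_field_smult:
  fixes X :: "(complex^'n) set"
  assumes X: "zariski_closed X" and D: "complete_field X D"
    and u: "u \<in> regular_functions X" "D (D u) = 0"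
  shows "complete_field X (\<lambda>h. u * D h)"
proof -
  obtain \<Phi> where vf: "D \<in> vector_fields X" and flow: "phase_flow X D \<Phi>"
    using D unfolding complete_field_def by blast
  have b: "D u \<in> regular_functions X" by (rule vf_regular[OF vf])
  \<comment> \<open>Polynomials replace \<open>u\<close> and \<open>D u\<close>, whose extensions by
    zero need not be continuous: \<tau> has to be holomorphic on the ambient space, not just on
    \<open>X\<close>.\<close>
  obtain pu where pu: "pu \<in> Pol" "u = restr X pu" using regular_closed_Pol[OF X u(1)] by blast
  obtain pb where pb: "pb \<in> Pol" "D u = restr X pb" using regular_closed_Pol[OF X b] by blast
  define \<tau> where "\<tau> = (\<lambda>z. pu (snd z) * (fst z * expquot (fst z * pb (snd z))))"
  have \<tau>: "\<tau> (t, x) = u x * (t * expquot (t * D u x))" if "x \<in> X" for t x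
    using that by (simp add: \<tau>_def pb(2)) (simp add: pu(2) restr_def)
  obtain e' where e': "\<And>z. (expquot has_field_derivative e' z) (at z)"
    using expquot_differentiable by metis
  have holo_\<tau>: "holo_at \<tau> z" for z
    unfolding \<tau>_def
    by (rule holo_at_mult holo_at_fst holo_at_Pol pu pb holo_at_compose[OF _ e'])+
  define \<Psi> where "\<Psi> = (\<lambda>t x. \<Phi> (\<tau> (t, x)) x)"
  have "holomorphic_action X \<Psi>"
    unfolding holomorphic_action_def
  proof (intro conjI allI ballI)
    show "\<Psi> t x \<in> X" if "x \<in> X" for t x unfolding \<Psi>_def by (rule flow_in[OF flow that])
    show "\<Psi> 0 x = x" if "x \<in> X" for x unfolding \<Psi>_def using flow_zero[OF flow that] by (simp add: \<tau>_def)
    show "\<Psi> (s + t) x = \<Psi> s (\<Psi> t x)" if x: "x \<in> X" for s t x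
    proof -
      let ?y = "\<Psi> t x"
      have y: "?y \<in> X" unfolding \<Psi>_def by (rule flow_in[OF flow x])
      have b_y: "D u ?y = D u x" unfolding \<Psi>_def by (rule flow_Ker[OF flow b u(2) x])
      have "u ?y = u x + \<tau> (t, x) * D u x" unfolding \<Psi>_def by (rule flow_affine[OF flow vf u x])
      \<comment> \<open>Here \<open>\<tau> (t, x) * D u x\<close> equals
        \<open>u x * (exp (t * D u x) - 1)\<close>.\<close>
      also have "\<dots> = u x * exp (t * D u x)"
        unfolding \<tau>[OF x] by (auto simp: expquot_def field_simps)
      finally have uy: "u ?y = u x * exp (t * D u x)" .
      have "\<tau> (s, ?y) + \<tau> (t, x) = \<tau> (s + t, x)"
        unfolding \<tau>[OF x] \<tau>[OF y] b_y uy expquot_cocycle by (simp add: algebra_simps)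
      then show ?thesis using flow_plus[OF flow x, of "\<tau> (s, ?y)" "\<tau> (t, x)"] by (simp add: \<Psi>_def)
    qed
    show "holomorphic_fun_on (UNIV \<times> X) (\<lambda>(t, x). \<Psi> t x $ i)" for i
      unfolding holomorphic_fun_on_def
    proof
      fix z :: "complex \<times> (complex^'n)" assume z: "z \<in> UNIV \<times> X"
      \<comment> \<open>\<Psi> is \<Phi> composed with \<open>H\<close>, so a local holomorphic
        extension of \<Phi> near \<open>H z\<close> pulls back to one of \<Psi> on the preimage of
        its domain.\<close>
      define H where "H = (\<lambda>z. (\<tau> z, snd z :: complex^'n))"
      have "holomorphic_fun_on (UNIV \<times> X) (\<lambda>(t, x). \<Phi> t x $ i)"
        using flow unfolding phase_flow_def holomorphic_action_def by blast
      moreover have "H z \<in> UNIV \<times> X" using z by (auto simp: H_def)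
      ultimately have "\<exists>W G. open W \<and> H z \<in> W \<and> (\<forall>w\<in>W. holo_at G w) \<and>
          (\<forall>w\<in>(UNIV \<times> X) \<inter> W. (case w of (t, x) \<Rightarrow> \<Phi> t x $ i) = G w)"
        unfolding holomorphic_fun_on_def holo_at_def by (rule bspec)
      then obtain W G where W: "open W" "H z \<in> W" and G: "\<forall>w\<in>W. holo_at G w"
        and eq: "\<forall>w\<in>(UNIV \<times> X) \<inter> W. (case w of (t, x) \<Rightarrow> \<Phi> t x $ i) = G w"
        by (elim exE conjE)
      have "continuous_on UNIV H" unfolding H_def
        by (intro continuous_intros continuous_at_imp_continuous_on ballI holo_at_imp_continuous holo_\<tau>)
      then have "open (H -` W)" using W(1) by (simp add: open_vimage)
      moreover have "holo_at (\<lambda>z. G (H z)) w" if "w \<in> H -` W" for w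
        unfolding H_def using that G by (intro holo_at_compose_fst holo_\<tau>) (auto simp: H_def)
      moreover have "(case w of (t, x) \<Rightarrow> \<Psi> t x $ i) = G (H w)" if "w \<in> (UNIV \<times> X) \<inter> (H -` W)" for w
        using that eq[rule_format, of "H w"] by (auto simp: H_def \<Psi>_def)
      ultimately show "\<exists>W G. open W \<and> z \<in> W \<and>
          (\<forall>w\<in>W. \<exists>G'. (G has_derivative G') (at w) \<and> (\<forall>c s v. G' (c * s, c *s v) = c * G' (s, v))) \<and>
          (\<forall>w\<in>(UNIV \<times> X) \<inter> W. (case w of (t, x) \<Rightarrow> \<Psi> t x $ i) = G w)"
        using W(2) unfolding holo_at_def
        by (intro exI[of _ "H -` W"] exI[of _ "\<lambda>z. G (H z)"]) auto
    qed
  qed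
  moreover have "((\<lambda>t. f (\<Psi> t x)) has_field_derivative (u * D f) x) (at 0)"
    if f: "f \<in> regular_functions X" and x: "x \<in> X" for f x
  proof -
    obtain d where d: "(expquot has_field_derivative d) (at 0)"
      using expquot_differentiable by blast
    have "((\<lambda>t. expquot (t * D u x)) has_field_derivative d * D u x) (at 0)"
      using d by (intro DERIV_chain2[where g = "\<lambda>t. t * D u x" and f = expquot]) (auto intro!: derivative_eq_intros)
    then have "((\<lambda>t. \<tau> (t, x)) has_field_derivative u x) (at 0)"
      unfolding \<tau>[OF x] by (auto intro!: derivative_eq_intros simp: expquot_def)
    moreover have "((\<lambda>s. f (\<Phi> s x)) has_field_derivative D f x) (at (\<tau> (0, x)))"
      using flow_deriv[OF flow f x, of 0] flow_zero[OF flow x] by (simp add: \<tau>_def)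
    ultimately have "((\<lambda>t. f (\<Phi> (\<tau> (t, x)) x)) has_field_derivative D f x * u x) (at 0)"
      by (intro DERIV_chain2[where g = "\<lambda>t. \<tau> (t, x)" and f = "\<lambda>s. f (\<Phi> s x)"])
    then show ?thesis by (simp add: \<Psi>_def mult.commute)
  qed
  ultimately have "phase_flow X (\<lambda>h. u * D h) \<Psi>" unfolding phase_flow_def by blast
  then show ?thesis using vf_smult[OF vf u(1)] unfolding complete_field_def by blast
qed

section \<open>Vector fields generated by a compatible pair\<close>

text \<open>With \<open>a f \<xi>\<close>, \<open>g \<eta>\<close>, \<open>f \<xi>\<close>, \<open>a g \<eta>\<close> all complete, one has
  \<open>[f \<xi>, a g \<eta>] - [a f \<xi>, g \<eta>] = f g \<xi>(a) \<eta>\<close>.\<close>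

lemma Lie_alg_Ker_products:
  fixes X :: "(complex^'n) set"
  assumes X: "zariski_closed X" and \<xi>: "complete_field X \<xi>" and \<eta>: "complete_field X \<eta>"
    and f: "f \<in> Ker X \<xi>" and g: "g \<in> Ker X \<eta>" and a: "a \<in> Ker X \<eta>" "\<xi> (\<xi> a) = 0"
  shows "(\<lambda>h. (f * g * \<xi> a) * \<eta> h) \<in> Lie_alg X"
proof -
  have vx: "\<xi> \<in> vector_fields X" and vy: "\<eta> \<in> vector_fields X"
    using \<xi> \<eta> by (auto simp: complete_field_def)
  have reg: "f \<in> regular_functions X" "g \<in> regular_functions X" "a \<in> regular_functions X"
    and ker: "\<xi> f = 0" "\<eta> g = 0" "\<eta> a = 0"
    using f g a by (auto simp: Ker_def)
  define C where "C = (\<lambda>h. f * \<xi> h)"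
  define E where "E = (\<lambda>h. (a * g) * \<eta> h)"
  define A where "A = (\<lambda>h. (a * f) * \<xi> h)"
  define B where "B = (\<lambda>h. g * \<eta> h)"
  note r = vf_regular[OF vx] vf_regular[OF vy] reg
  \<comment> \<open>All four fields have the form u D with D (D u) = 0: \<open>f\<close> lies in Ker
    \<xi>, \<xi> applied twice to \<open>a * f\<close> gives \<open>f * \<xi> (\<xi> a) = 0\<close>,
    and \<open>g\<close> and \<open>a * g\<close> lie in Ker \<eta>.\<close>
  have "C \<in> Lie_alg X" unfolding C_def
    by (intro Lie_alg.complete complete_field_smult[OF X \<xi>]) (use r ker vf_zero[OF vx] in auto)
  moreover have "E \<in> Lie_alg X" unfolding E_def
    by (intro Lie_alg.complete complete_field_smult[OF X \<eta>])
      (use r ker vf_zero[OF vy] in \<open>auto simp: vf_mult[OF vy] intro: regular_mult\<close>)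
  moreover have "A \<in> Lie_alg X" unfolding A_def
    by (intro Lie_alg.complete complete_field_smult[OF X \<xi>])
      (use r ker a(2) in \<open>auto simp: vf_mult[OF vx] intro: regular_mult\<close>)
  moreover have "B \<in> Lie_alg X" unfolding B_def
    by (intro Lie_alg.complete complete_field_smult[OF X \<eta>]) (use r ker vf_zero[OF vy] in auto)
  ultimately have "lie_bracket C E + (\<lambda>h x. (-1) * lie_bracket A B h x) \<in> Lie_alg X"
    by (intro Lie_alg.add Lie_alg.scale Lie_alg.bracket)
  moreover have "lie_bracket C E + (\<lambda>h x. (-1) * lie_bracket A B h x) = (\<lambda>h. (f * g * \<xi> a) * \<eta> h)"
  proof
    fix h
    \<comment> \<open>The second-order terms and those with \<open>\<xi> g\<close> or
      \<open>\<eta> f\<close> occur equally in both brackets and cancel; \<open>\<eta> a = 0\<close>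
      removes the remaining \<xi> term.\<close>
    have m: "\<xi> (g * \<eta> h) = g * \<xi> (\<eta> h) + \<eta> h * \<xi> g"
      "\<eta> ((a * f) * \<xi> h) = (a * f) * \<eta> (\<xi> h) + \<xi> h * \<eta> (a * f)" "\<eta> (a * f) = a * \<eta> f + f * \<eta> a"
      "\<xi> ((a * g) * \<eta> h) = (a * g) * \<xi> (\<eta> h) + \<eta> h * \<xi> (a * g)" "\<xi> (a * g) = a * \<xi> g + g * \<xi> a"
      "\<eta> (f * \<xi> h) = f * \<eta> (\<xi> h) + \<xi> h * \<eta> f"
      by (intro vf_mult[OF vx] vf_mult[OF vy] r regular_mult)+
    show "(lie_bracket C E + (\<lambda>h x. (-1) * lie_bracket A B h x)) h = (f * g * \<xi> a) * \<eta> h"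
      unfolding lie_bracket_def plus_fun_apply A_def B_def C_def E_def m ker
      by (rule ext) (simp add: algebra_simps)
  qed
  ultimately show ?thesis by simp
qed

lemma Lie_alg_sum:
  "(\<And>i. i \<in> K \<Longrightarrow> E i \<in> Lie_alg X) \<Longrightarrow> (\<lambda>g x. \<Sum>i\<in>K. E i g x) \<in> Lie_alg X"
proof (induction K rule: infinite_finite_induct)
  case (insert i K)
  have "(\<lambda>g x. \<Sum>i\<in>insert i K. E i g x) = E i + (\<lambda>g x. \<Sum>i\<in>K. E i g x)"
    using insert.hyps by (auto simp: fun_eq_iff)
  then show ?case using insert by (auto intro: Lie_alg.add)
qed (use Lie_alg.zero[of X] in \<open>auto simp: zero_fun_def\<close>)

text \<open>The exponent \<open>m\<close> depends on \<open>h\<close>, because denominators in the span of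
  \<open>Ker \<xi> \<cdot> Ker \<eta>\<close> on \<open>U\<close> are unbounded.\<close>

lemma compatible_Lie_alg:
  fixes X :: "(complex^'n) set"
  assumes X: "affine_variety X" and \<xi>: "complete_field X \<xi>" and \<eta>: "complete_field X \<eta>"
    and a: "a \<in> Ker X \<xi>" "a \<in> Ker X \<eta>" and U: "U = {x\<in>X. a x \<noteq> 0}"
    and comp: "compatible U (restrict_field X U \<xi>) (restrict_field X U \<eta>)"
  obtains w where "w \<in> regular_functions X" "w \<noteq> 0"
    "\<And>h. h \<in> regular_functions X \<Longrightarrow>
      \<exists>m. \<forall>\<beta>\<in>Ker X \<eta>. (\<lambda>g. (\<beta> * a ^ m * (h * w)) * \<eta> g) \<in> Lie_alg X"
proof -
  let ?\<xi> = "restrict_field X U \<xi>" and ?\<eta> = "restrict_field X U \<eta>"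
  have cl: "zariski_closed X" using X by (simp add: affine_variety_def)
  have vx: "\<xi> \<in> vector_fields X" and vy: "\<eta> \<in> vector_fields X"
    using \<xi> \<eta> by (auto simp: complete_field_def)
  have aX: "a \<in> regular_functions X" using a by (simp add: Ker_def)
  have vx': "?\<xi> \<in> vector_fields U" by (rule restrict_field(1)[OF cl vx a(1) U])
  obtain I where I: "ideal I (coordinate_ring U)" "I \<noteq> {0}"
    and I_span: "I \<subseteq> cfun.span {f * g | f g. f \<in> Ker U ?\<xi> \<and> g \<in> Ker U ?\<eta>}"
    using comp unfolding compatible_def semi_compatible_def by blast
  obtain b where b: "b \<in> Ker U ?\<eta>" "?\<xi> b \<noteq> 0" "?\<xi> (?\<xi> b) = 0"
    using comp unfolding compatible_def by blast
  have bU: "b \<in> regular_functions U" using b(1) by (simp add: Ker_def)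
  have "?\<xi> b \<in> Ker U ?\<xi>" using b(3) vf_regular[OF vx'] by (simp add: Ker_def)
  then obtain m1 where m1: "\<And>n. n \<ge> m1 \<Longrightarrow> a ^ n * ?\<xi> b \<in> Ker X \<xi>"
    using Ker_restrict_field_extend[OF cl vx a(1) U] by blast
  obtain m2 where m2: "\<And>n. n \<ge> m2 \<Longrightarrow> a ^ n * b \<in> Ker X \<eta>"
    using Ker_restrict_field_extend[OF cl vy a(2) U b(1)] by blast
  define k where "k = max m1 m2"
  \<comment> \<open>\<open>k\<close> powers of \<open>a\<close> bring \<open>b\<close> into Ker
    \<eta> and its derivative into Ker \<xi>. The additional factor is needed since
    \<open>\<xi> (a ^ k * b)\<close> is computed from the restricted field only on
    \<open>U\<close>.\<close>
  define v where "v = a ^ Suc k * b"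
  have v_Ker: "v \<in> Ker X \<eta>" unfolding v_def by (rule m2) (simp add: k_def)
  have kX: "a ^ k * b \<in> regular_functions X" using m2[of k] by (simp add: k_def Ker_def)
  have \<xi>v: "\<xi> v = a ^ Suc k * ?\<xi> b"
  proof -
    have "\<xi> v = a * \<xi> (a ^ k * b)"
      using vf_Ker_mult[OF vx a(1) kX] by (simp only: v_def power_Suc mult.assoc)
    also have "\<dots> = a * restr U (\<xi> (a ^ k * b))"
      using regular_outside[OF vf_regular[OF vx]] by (auto simp: fun_eq_iff restr_def U)
    also have "restr U (\<xi> (a ^ k * b)) = a ^ k * ?\<xi> b"
      by (rule restrict_field_power_mult[OF cl vx a(1) U bU kX])
    finally show ?thesis by (simp only: power_Suc mult.assoc)
  qed
  have \<xi>\<xi>v: "\<xi> (\<xi> v) = 0" using m1[of "Suc k"] unfolding \<xi>v by (simp add: Ker_def k_def)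
  have nonzero: "a ^ n * f \<noteq> 0" if f: "f \<in> regular_functions U" "f \<noteq> 0" for f n
  proof -
    obtain x where x: "f x \<noteq> 0" using f(2) by (auto simp: fun_eq_iff)
    then have "x \<in> U" using regular_outside[OF f(1)] by blast
    then have "(a ^ n * f) x \<noteq> 0" using x by (simp add: U)
    then show ?thesis by force
  qed
  have \<xi>v0: "\<xi> v \<noteq> 0" unfolding \<xi>v by (rule nonzero[OF vf_regular[OF vx'] b(2)])
  interpret I: ideal I "coordinate_ring U" by (rule I(1))
  have "0 \<in> I" using additive_subgroup.zero_closed[OF ideal.axioms(1)[OF I(1)]]
    by (simp add: coordinate_ring_def)
  then obtain c where c: "c \<in> I" "c \<noteq> 0" using I(2) by blast
  have cU: "c \<in> regular_functions U" using I.Icarr[OF c(1)] by (simp add: coordinate_ring_def)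
  obtain l where l: "a ^ l * c \<in> regular_functions X"
    using regular_extend[OF cl aX U cU] by blast
  \<comment> \<open>Claimed for all large \<open>n\<close>, so that two summands can share an
    exponent, and for all \<beta>, chosen after the exponent, as the partition of unity
    requires.\<close>
  have span: "\<exists>m. \<forall>n\<ge>m. \<forall>\<beta>\<in>Ker X \<eta>. (\<lambda>h. (\<beta> * a ^ n * y * \<xi> v) * \<eta> h) \<in> Lie_alg X"
    if "y \<in> cfun.span {f * g | f g. f \<in> Ker U ?\<xi> \<and> g \<in> Ker U ?\<eta>}" for y
    using that
  proof (induction rule: cfun.span_induct_alt)
    case base
    have "(\<lambda>h. (\<beta> * a ^ n * 0 * \<xi> v) * \<eta> h) \<in> Lie_alg X" for \<beta> n
    proof -
      have "(\<lambda>h. (\<beta> * a ^ n * 0 * \<xi> v) * \<eta> h) = 0" by (intro ext) simp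
      then show ?thesis using Lie_alg.zero[of X] by (simp only:)
    qed
    then show ?case by blast
  next
    case (step s x y)
    obtain f g where x: "x = f * g" and f: "f \<in> Ker U ?\<xi>" and g: "g \<in> Ker U ?\<eta>" using step(1) by blast
    obtain p where p: "\<And>n. n \<ge> p \<Longrightarrow> a ^ n * f \<in> Ker X \<xi>"
      using Ker_restrict_field_extend[OF cl vx a(1) U f] by blast
    obtain q where q: "\<And>n. n \<ge> q \<Longrightarrow> a ^ n * g \<in> Ker X \<eta>"
      using Ker_restrict_field_extend[OF cl vy a(2) U g] by blast
    obtain m where m: "\<And>n \<beta>. n \<ge> m \<Longrightarrow> \<beta> \<in> Ker X \<eta> \<Longrightarrow>
        (\<lambda>h. (\<beta> * a ^ n * y * \<xi> v) * \<eta> h) \<in> Lie_alg X"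
      using step(2) by blast
    have "(\<lambda>h. (\<beta> * a ^ n * ((\<lambda>t. s * x t) + y) * \<xi> v) * \<eta> h) \<in> Lie_alg X"
      if n: "n \<ge> p + q + m" and \<beta>: "\<beta> \<in> Ker X \<eta>" for n \<beta>
    proof -
      \<comment> \<open>The power is divided between the factors: \<open>a ^ p\<close> extends
        \<open>f\<close> into Ker \<xi>, and the rest extends \<open>g\<close> into Ker \<eta>,
        where \<beta> is absorbed as well.\<close>
      have "\<beta> * (a ^ (n - p) * g) \<in> Ker X \<eta>"
        using n by (intro Ker_mult[OF vy \<beta>] q) simp
      then have "(\<lambda>h. ((a ^ p * f) * (\<beta> * (a ^ (n - p) * g)) * \<xi> v) * \<eta> h) \<in> Lie_alg X"
        using p by (intro Lie_alg_Ker_products[OF cl \<xi> \<eta> _ _ v_Ker \<xi>\<xi>v]) auto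
      from Lie_alg.add[OF Lie_alg.scale[OF this, of s] m[OF _ \<beta>, of n]]
      have "(\<lambda>h t. s * ((a ^ p * f) * (\<beta> * (a ^ (n - p) * g)) * \<xi> v * \<eta> h) t) +
          (\<lambda>h. (\<beta> * a ^ n * y * \<xi> v) * \<eta> h) \<in> Lie_alg X" using n by simp
      moreover have "(\<lambda>h t. s * ((a ^ p * f) * (\<beta> * (a ^ (n - p) * g)) * \<xi> v * \<eta> h) t) +
          (\<lambda>h. (\<beta> * a ^ n * y * \<xi> v) * \<eta> h) = (\<lambda>h. (\<beta> * a ^ n * ((\<lambda>t. s * x t) + y) * \<xi> v) * \<eta> h)"
      proof (intro ext)
        fix h t
        have e: "a t ^ n = a t ^ p * a t ^ (n - p)" using n by (simp flip: power_add)
        show "((\<lambda>h t. s * ((a ^ p * f) * (\<beta> * (a ^ (n - p) * g)) * \<xi> v * \<eta> h) t) +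
          (\<lambda>h. (\<beta> * a ^ n * y * \<xi> v) * \<eta> h)) h t =
          ((\<beta> * a ^ n * ((\<lambda>t. s * x t) + y) * \<xi> v) * \<eta> h) t"
          by (simp add: x e algebra_simps)
      qed
      ultimately show ?thesis by simp
    qed
    then show ?case by blast
  qed
  \<comment> \<open>The witness is independent of \<open>h\<close>: \<open>a ^ l * c\<close> is a
    nonzero element of \<open>I\<close> extended to \<open>X\<close>, and \<open>\<xi> v\<close> is
    the factor produced by the brackets.\<close>
  show thesis
  proof (rule that[of "(a ^ l * c) * \<xi> v"])
    show "(a ^ l * c) * \<xi> v \<in> regular_functions X"
      by (rule regular_mult[OF l vf_regular[OF vx]])
    show "(a ^ l * c) * \<xi> v \<noteq> 0"
      by (rule regular_mult_nonzero[OF X l nonzero[OF cU c(2)] vf_regular[OF vx] \<xi>v0])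
    fix h assume h: "h \<in> regular_functions X"
    have "restr U (a ^ l * h) \<in> regular_functions U"
      using regular_restr[OF regular_power_mult[OF aX h], of U] U by auto
    then have "restr U (a ^ l * h) * c \<in> I"
      using I.I_l_closed[OF c(1)] by (simp add: coordinate_ring_def)
    moreover have "restr U (a ^ l * h) * c = h * (a ^ l * c)"
      using regular_outside[OF cU] by (auto simp: fun_eq_iff restr_def)
    ultimately have "h * (a ^ l * c) \<in> I" by simp
    then obtain m where m: "\<And>\<beta>. \<beta> \<in> Ker X \<eta> \<Longrightarrow> (\<lambda>g. (\<beta> * a ^ m * (h * (a ^ l * c)) * \<xi> v) * \<eta> g) \<in> Lie_alg X"
      using span[OF subsetD[OF I_span]] by (meson order_refl)
    show "\<exists>m. \<forall>\<beta>\<in>Ker X \<eta>. (\<lambda>g. (\<beta> * a ^ m * (h * ((a ^ l * c) * \<xi> v))) * \<eta> g) \<in> Lie_alg X"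
    proof (intro exI ballI)
      fix \<beta> assume "\<beta> \<in> Ker X \<eta>"
      from m[OF this] show "(\<lambda>g. (\<beta> * a ^ m * (h * ((a ^ l * c) * \<xi> v))) * \<eta> g) \<in> Lie_alg X"
        by (simp only: mult.assoc)
    qed
  qed
qed

section \<open>Gluing over \<open>B\<close>\<close>

theorem theorem8p1:
  fixes X :: "(complex ^ 'n) set" and B :: "(complex ^ 'm) set"
    and \<pi> :: "complex ^ 'n \<Rightarrow> complex ^ 'm"
    and \<eta> :: "(complex ^ 'n) vector_field"
    and k :: nat
    and \<alpha> :: "nat \<Rightarrow> complex ^ 'm \<Rightarrow> complex"
    and \<xi> :: "nat \<Rightarrow> (complex ^ 'n) vector_field"
    and D :: "nat \<Rightarrow> (complex ^ 'n) set"
  assumes "smooth_affine_variety X" and "smooth_affine_variety B"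
    and "morphism_on X B \<pi>" and "\<pi> ` X = B"
    and "locally_nilpotent X \<eta> \<or> semi_simple X \<eta>"
    and "\<forall>g \<in> regular_functions B. pullback X \<pi> g \<in> Ker X \<eta>"
    and "\<forall>i\<in>{1..k}. \<alpha> i \<in> regular_functions B"
    and "\<not> (\<exists>b\<in>B. \<forall>i\<in>{1..k}. \<alpha> i b = 0)"
    and "\<forall>i\<in>{1..k}. D i = zero_locus X (pullback X \<pi> (\<alpha> i))"
    and "\<forall>i\<in>{1..k}. locally_nilpotent X (\<xi> i)"
    and "\<forall>i\<in>{1..k}. pullback X \<pi> (\<alpha> i) \<in> Ker X (\<xi> i)"
    and "\<forall>i\<in>{1..k}. compatible (X - D i)
           (restrict_field X (X - D i) (\<xi> i)) (restrict_field X (X - D i) \<eta>)"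
  shows "\<exists>J. ideal J (coordinate_ring X) \<and> J \<noteq> {0} \<and>
           (\<forall>f\<in>J. (\<lambda>g. f * \<eta> g) \<in> Lie_alg X)"
proof -
  have X: "affine_variety X" and cl: "zariski_closed B"
    using assms(1,2) by (auto simp: smooth_affine_variety_def affine_variety_def)
  have \<eta>: "complete_field X \<eta>"
    using assms(5) unfolding complete_field_def locally_nilpotent_def semi_simple_def by blast
  define a where "a = (\<lambda>i. pullback X \<pi> (\<alpha> i))"
  have "\<exists>w. w \<in> regular_functions X \<and> w \<noteq> 0 \<and> (\<forall>h\<in>regular_functions X.
      \<exists>m. \<forall>\<beta>\<in>Ker X \<eta>. (\<lambda>g. (\<beta> * a i ^ m * (h * w)) * \<eta> g) \<in> Lie_alg X)"
    if i: "i \<in> {1..k}" for i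
  proof -
    have \<xi>: "complete_field X (\<xi> i)"
      using assms(10) i unfolding complete_field_def locally_nilpotent_def by blast
    have a: "a i \<in> Ker X (\<xi> i)" "a i \<in> Ker X \<eta>" using assms(6,7,11) i unfolding a_def by auto
    have U: "X - D i = {x\<in>X. a i x \<noteq> 0}"
      using assms(9) i by (auto simp: zero_locus_def a_def)
    show ?thesis
    proof (rule compatible_Lie_alg[OF X \<xi> \<eta> a U])
      show "compatible (X - D i) (restrict_field X (X - D i) (\<xi> i)) (restrict_field X (X - D i) \<eta>)"
        using assms(12) i by blast
      fix w
      assume w: "w \<in> regular_functions X" "w \<noteq> 0" "\<And>h. h \<in> regular_functions X \<Longrightarrow>
        \<exists>m. \<forall>\<beta>\<in>Ker X \<eta>. (\<lambda>g. (\<beta> * a i ^ m * (h * w)) * \<eta> g) \<in> Lie_alg X"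
      then show ?thesis by (intro exI[of _ w] conjI ballI w)
    qed
  qed
  then obtain w where w: "\<And>i. i \<in> {1..k} \<Longrightarrow> w i \<in> regular_functions X" "\<And>i. i \<in> {1..k} \<Longrightarrow> w i \<noteq> 0"
    and w_Lie: "\<And>i h. i \<in> {1..k} \<Longrightarrow> h \<in> regular_functions X \<Longrightarrow>
      \<exists>m. \<forall>\<beta>\<in>Ker X \<eta>. (\<lambda>g. (\<beta> * a i ^ m * (h * w i)) * \<eta> g) \<in> Lie_alg X"
    by metis
  have one: "restr X (\<lambda>_. 1) \<in> regular_functions X" by (rule regular_restr_Pol) simp
  \<comment> \<open>The unit of the coordinate ring keeps the empty product zero off
    \<open>X\<close>. Subsets \<open>K\<close> are allowed because the cofactor of each
    \<open>w i\<close> is needed too.\<close>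
  define W where "W = (\<lambda>K. restr X (\<lambda>_. 1) * (\<Prod>i\<in>K. w i))"
  have W: "W K \<in> regular_functions X \<and> W K \<noteq> 0" if "finite K" "K \<subseteq> {1..k}" for K
    using that
  proof (induction K rule: finite_induct)
    case empty
    then show ?case using one restr_one_nonzero[OF X] by (simp only: W_def prod.empty mult_1_right) simp
  next
    case (insert i K)
    then have "W (insert i K) = w i * W K" by (simp add: W_def algebra_simps)
    then show ?case using insert w[of i] by (simp only: insert_subset regular_mult regular_mult_nonzero[OF X] simp_thms)
  qed
  define G where "G = W {1..k}"
  have G: "G \<in> regular_functions X" "G \<noteq> 0" using W[of "{1..k}"] by (auto simp: G_def)
  \<comment> \<open>\<open>G\<close> is a multiple of every \<open>w i\<close>, and the cofactor is
    absorbed into the arbitrary function \<open>h\<close>.\<close>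
  have G_Lie: "\<exists>m. \<forall>\<beta>\<in>Ker X \<eta>. (\<lambda>g. (\<beta> * a i ^ m * (h * G)) * \<eta> g) \<in> Lie_alg X"
    if i: "i \<in> {1..k}" and h: "h \<in> regular_functions X" for i h
  proof -
    have "h * G = (h * W ({1..k} - {i})) * w i"
      unfolding G_def W_def using i by (subst prod.remove[of _ i]) (auto simp: algebra_simps)
    moreover have "h * W ({1..k} - {i}) \<in> regular_functions X" using W h by (intro regular_mult) auto
    ultimately show ?thesis using w_Lie[OF i] by simp
  qed
  interpret R: cring "coordinate_ring X" by (rule cring_coordinate_ring)
  have GR: "G \<in> carrier (coordinate_ring X)" using G by (simp add: coordinate_ring_def)
  have "(\<lambda>g. f * \<eta> g) \<in> Lie_alg X" if f: "f \<in> PIdl\<^bsub>coordinate_ring X\<^esub> G" for f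
  proof -
    obtain h where h: "h \<in> regular_functions X" and f: "f = h * G"
      using f by (auto simp: cgenideal_def coordinate_ring_def)
    obtain m where m: "\<And>i \<beta>. i \<in> {1..k} \<Longrightarrow> \<beta> \<in> Ker X \<eta> \<Longrightarrow>
        (\<lambda>g. (\<beta> * a i ^ m i * f) * \<eta> g) \<in> Lie_alg X"
      using G_Lie[OF _ h] unfolding f by metis
    \<comment> \<open>Chosen separately for each \<open>f\<close>, since the exponents
      \<open>m i\<close> depend on it; the sum over \<open>i\<close> then recovers \<open>f\<close>
      times \<eta>.\<close>
    obtain \<beta> where \<beta>: "\<And>i. i \<in> {1..k} \<Longrightarrow> \<beta> i \<in> regular_functions B"
      "\<And>b. b \<in> B \<Longrightarrow> (\<Sum>i\<in>{1..k}. \<beta> i b * \<alpha> i b ^ m i) = 1"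
      using regular_partition_of_unity[OF cl, of "{1..k}" \<alpha> m] assms(7,8) by blast
    have "(\<lambda>g. (pullback X \<pi> (\<beta> i) * a i ^ m i * f) * \<eta> g) \<in> Lie_alg X" if "i \<in> {1..k}" for i
      using m[OF that] assms(6) \<beta>(1)[OF that] by blast
    then have "(\<lambda>g x. \<Sum>i\<in>{1..k}. ((pullback X \<pi> (\<beta> i) * a i ^ m i * f) * \<eta> g) x) \<in> Lie_alg X"
      by (rule Lie_alg_sum)
    moreover have "(\<Sum>i\<in>{1..k}. ((pullback X \<pi> (\<beta> i) * a i ^ m i * f) * \<eta> g) x) = (f * \<eta> g) x" for g x
    proof (cases "x \<in> X")
      case True
      then have "(\<Sum>i\<in>{1..k}. ((pullback X \<pi> (\<beta> i) * a i ^ m i * f) * \<eta> g) x)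
          = (\<Sum>i\<in>{1..k}. \<beta> i (\<pi> x) * \<alpha> i (\<pi> x) ^ m i) * (f x * \<eta> g x)"
        by (simp add: pullback_def restr_def a_def sum_distrib_right mult.assoc)
      moreover have "\<pi> x \<in> B" using True assms(4) by blast
      ultimately show ?thesis using \<beta>(2) by simp
    next
      case False
      then show ?thesis using regular_outside[OF G(1)] by (simp add: f)
    qed
    ultimately show ?thesis by (simp add: fun_eq_iff times_fun_def)
  qed
  moreover have "PIdl\<^bsub>coordinate_ring X\<^esub> G \<noteq> {0}"
    using R.cgenideal_self[OF GR] G(2) by blast
  ultimately show ?thesis using R.cgenideal_ideal[OF GR] by blast
qed

end
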